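(* Let $T'$ be a complete countable NIP theory in a language $\mathcal L'$ with monster model $\mathcal U$, let $F\subseteq\mathcal U$ be a small subset, and let $T=\mathrm{Th}(\mathcal U_F)$ in the language $\mathcal L=\mathcal L'(F)$. Working in $T$ (with monster model again denoted $\mathcal U$): For any (small) set $A\subseteq\mathcal U$, there exists a model $M\supseteq A$ of $T$ which is compressibly constructible over $A$ and of cardinality $\leq|A|+|T|$. Moreover, if $B$ is compressibly constructible over $A$ then there is some model $M\supseteq B$ of $T$ which is compressibly constructible over $A$ and of cardinality $\leq|B|+|T|$.
   Context: $\mathcal U$ is a large saturated model; small means of cardinality $<|\mathcal U|$; models and sets are small and contained in $\mathcal U$ (models being elementary substructures); $\vdash$ is implication in $\mathcal U$. $\mathcal U_F$ is the expansion of $\mathcal U$ by constants for the elements of $F$. $|T|$ denotes the cardinality of the set of $\mathcal L$-formulas. A theory is NIP if for every formula $\phi(x,y)$ the family $\{\phi(\mathcal U^x,b):b\in\mathcal U^y\}$ has finite VC-dimension. A type $p(x)\in S(A)$ is compressible if for every $\mathcal L$-formula $\phi(x,y)$ there is an $\mathcal L$-formula $\psi(x,z)$ such that for every finite $A_0\subseteq A$ there is $c\in A^z$ with $\psi(x,c)\in p$ and $\psi(x,c)\vdash\{\phi(x,a)\in p:a\in A_0^y\}\cup\{\neg\phi(x,a)\in p:a\in A_0^y\}$. $B$ is compressibly constructible over $A$ if $B$ can be enumerated as $B=(b_i)_{i<\alpha}$ for some ordinal $\alpha$ such that $\mathrm{tp}(b_i/A\cup\{b_j:j<i\})$ is compressible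 for all $i<\alpha$. *)

theory Defs
  imports "HOL-Library.FuncSet" "HOL-Library.Equipollence" "HOL-Library.Extended_Nat"
begin

section \<open>First-order logic\<close>

datatype 'f tm = Var nat | Fun 'f "'f tm list"

datatype ('f, 'r) fm =
    Eq "'f tm" "'f tm"
  | Rel 'r "'f tm list"
  | Neg "('f, 'r) fm"
  | Conj "('f, 'r) fm" "('f, 'r) fm"
  | Exists nat "('f, 'r) fm"

record ('f, 'r) lang =
  fsyms :: "'f set"
  farity :: "'f \<Rightarrow> nat"
  rsyms :: "'r set"
  rarity :: "'r \<Rightarrow> nat"

record ('f, 'r, 'a) struc =
  carrier :: "'a set"
  fint :: "'f \<Rightarrow> 'a list \<Rightarrow> 'a"
  rint :: "'r \<Rightarrow> 'a list \<Rightarrow> bool"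

fun fv_tm :: "'f tm \<Rightarrow> nat set" where
  "fv_tm (Var x) = {x}"
| "fv_tm (Fun f ts) = (\<Union>t\<in>set ts. fv_tm t)"

primrec fv :: "('f, 'r) fm \<Rightarrow> nat set" where
  "fv (Eq s t) = fv_tm s \<union> fv_tm t"
| "fv (Rel R ts) = (\<Union>t\<in>set ts. fv_tm t)"
| "fv (Neg \<phi>) = fv \<phi>"
| "fv (Conj \<phi> \<psi>) = fv \<phi> \<union> fv \<psi>"
| "fv (Exists x \<phi>) = fv \<phi> - {x}"

fun wf_tm :: "('f, 'r) lang \<Rightarrow> 'f tm \<Rightarrow> bool" where
  "wf_tm L (Var x) = True"
| "wf_tm L (Fun f ts) = (f \<in> fsyms L \<and> length ts = farity L f \<and> (\<forall>t\<in>set ts. wf_tm L t))"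

primrec wf_fm :: "('f, 'r) lang \<Rightarrow> ('f, 'r) fm \<Rightarrow> bool" where
  "wf_fm L (Eq s t) = (wf_tm L s \<and> wf_tm L t)"
| "wf_fm L (Rel R ts) = (R \<in> rsyms L \<and> length ts = rarity L R \<and> (\<forall>t\<in>set ts. wf_tm L t))"
| "wf_fm L (Neg \<phi>) = wf_fm L \<phi>"
| "wf_fm L (Conj \<phi> \<psi>) = (wf_fm L \<phi> \<and> wf_fm L \<psi>)"
| "wf_fm L (Exists x \<phi>) = wf_fm L \<phi>"

definition formulas :: "('f, 'r) lang \<Rightarrow> ('f, 'r) fm set" where
  "formulas L = {\<phi>. wf_fm L \<phi>}"

definition formulas_in :: "('f, 'r) lang \<Rightarrow> nat set \<Rightarrow> ('f, 'r) fm set" where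
  "formulas_in L X = {\<phi> \<in> formulas L. fv \<phi> \<subseteq> X}"

definition sentences :: "('f, 'r) lang \<Rightarrow> ('f, 'r) fm set" where
  "sentences L = formulas_in L {}"

definition is_struc :: "('f, 'r) lang \<Rightarrow> ('f, 'r, 'a) struc \<Rightarrow> bool" where
  "is_struc L U \<longleftrightarrow> carrier U \<noteq> {} \<and>
     (\<forall>f\<in>fsyms L. \<forall>as. length as = farity L f \<and> set as \<subseteq> carrier U \<longrightarrow> fint U f as \<in> carrier U)"

primrec eval :: "('f, 'r, 'a) struc \<Rightarrow> (nat \<Rightarrow> 'a) \<Rightarrow> 'f tm \<Rightarrow> 'a" where
  "eval U v (Var x) = v x"
| "eval U v (Fun f ts) = fint U f (map (eval U v) ts)"

primrec sat :: "('f, 'r, 'a) struc \<Rightarrow> (nat \<Rightarrow> 'a) \<Rightarrow> ('f, 'r) fm \<Rightarrow> bool" where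
  "sat U v (Eq s t) = (eval U v s = eval U v t)"
| "sat U v (Rel R ts) = rint U R (map (eval U v) ts)"
| "sat U v (Neg \<phi>) = (\<not> sat U v \<phi>)"
| "sat U v (Conj \<phi> \<psi>) = (sat U v \<phi> \<and> sat U v \<psi>)"
| "sat U v (Exists x \<phi>) = (\<exists>a\<in>carrier U. sat U (v(x := a)) \<phi>)"

definition models :: "('f, 'r, 'a) struc \<Rightarrow> ('f, 'r) fm set \<Rightarrow> bool" where
  "models U T \<longleftrightarrow> (\<forall>\<sigma>\<in>T. \<forall>v. range v \<subseteq> carrier U \<longrightarrow> sat U v \<sigma>)"

text \<open>Entailment ranges over the structures whose carrier is a subset of \<^typ>\<open>'a\<close>. When
  \<^typ>\<open>'a\<close> is infinite and \<open>L\<close> is countable this is first-order entailment, by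
  the downward Loewenheim-Skolem theorem.\<close>

definition entails ::
    "'a itself \<Rightarrow> ('f, 'r) lang \<Rightarrow> ('f, 'r) fm set \<Rightarrow> ('f, 'r) fm \<Rightarrow> bool" where
  "entails _ L T \<sigma> \<longleftrightarrow>
     (\<forall>N :: ('f, 'r, 'a) struc. is_struc L N \<and> models N T \<longrightarrow> models N {\<sigma>})"

definition complete_theory :: "'a itself \<Rightarrow> ('f, 'r) lang \<Rightarrow> ('f, 'r) fm set \<Rightarrow> bool" where
  "complete_theory ty L T \<longleftrightarrow> T \<subseteq> sentences L \<and>
     (\<exists>N :: ('f, 'r, 'a) struc. is_struc L N \<and> models N T) \<and>
     (\<forall>\<sigma>\<in>sentences L. entails ty L T \<sigma> \<or> entails ty L T (Neg \<sigma>))"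

definition Th :: "('f, 'r) lang \<Rightarrow> ('f, 'r, 'a) struc \<Rightarrow> ('f, 'r) fm set" where
  "Th L U = {\<sigma> \<in> sentences L. models U {\<sigma>}}"


section \<open>Expansion by constants\<close>

definition lang_const :: "('f, 'r) lang \<Rightarrow> 'a set \<Rightarrow> ('f + 'a, 'r) lang" where
  "lang_const L A =
     \<lparr>fsyms = Inl ` fsyms L \<union> Inr ` A, farity = case_sum (farity L) (\<lambda>_. 0),
      rsyms = rsyms L, rarity = rarity L\<rparr>"

text \<open>Every element \<open>a\<close> interprets the symbol \<open>Inr a\<close>. Read in the language
  \<open>lang_const L A\<close>, this is the expansion of \<open>U\<close> by constants for the elements of \<open>A\<close>.\<close>

definition struc_const :: "('f, 'r, 'a) struc \<Rightarrow> ('f + 'a, 'r, 'a) struc" where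
  "struc_const U =
     \<lparr>carrier = carrier U, fint = case_sum (fint U) (\<lambda>a _. a), rint = rint U\<rparr>"

primrec inst_tm :: "nat set \<Rightarrow> (nat \<Rightarrow> 'a) \<Rightarrow> 'f tm \<Rightarrow> ('f + 'a) tm" where
  "inst_tm Y a (Var x) = (if x \<in> Y then Fun (Inr (a x)) [] else Var x)"
| "inst_tm Y a (Fun f ts) = Fun (Inl f) (map (inst_tm Y a) ts)"

text \<open>\<open>inst Y a \<phi>\<close> is \<open>\<phi>(x,a)\<close>: the free variables in \<open>Y\<close> are replaced by the
  constants naming \<open>a\<close>.\<close>

primrec inst :: "nat set \<Rightarrow> (nat \<Rightarrow> 'a) \<Rightarrow> ('f, 'r) fm \<Rightarrow> ('f + 'a, 'r) fm" where
  "inst Y a (Eq s t) = Eq (inst_tm Y a s) (inst_tm Y a t)"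
| "inst Y a (Rel R ts) = Rel R (map (inst_tm Y a) ts)"
| "inst Y a (Neg \<phi>) = Neg (inst Y a \<phi>)"
| "inst Y a (Conj \<phi> \<psi>) = Conj (inst Y a \<phi>) (inst Y a \<psi>)"
| "inst Y a (Exists x \<phi>) = Exists x (inst (Y - {x}) a \<phi>)"

lemma eval_inst_tm:
  "eval (struc_const U) v (inst_tm Y a t) = eval U (override_on v a Y) t"
  by (induction t) (auto simp: struc_const_def o_def intro!: arg_cong[where f = "fint U _"])

lemma sat_inst:
  "sat (struc_const U) v (inst Y a \<phi>) \<longleftrightarrow> sat U (override_on v a Y) \<phi>"
proof (induction \<phi> arbitrary: Y v)
  case (Rel R ts)
  then show ?case
    by (simp add: eval_inst_tm o_def) (simp add: struc_const_def)
next
  case (Exists x \<phi>)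
  have upd: "override_on (v(x := b)) a (Y - {x}) = (override_on v a Y)(x := b)" for b
    by (auto simp: override_on_def)
  have "carrier (struc_const U) = carrier U"
    by (simp add: struc_const_def)
  then show ?case
    by (simp only: inst.simps sat.simps Exists upd)
qed (simp_all add: eval_inst_tm)


section \<open>Types, saturation, elementary submodels\<close>

text \<open>A finite tuple of variables without repetition is a finite set \<open>X\<close> of variables, and the
  tuples of that sort from \<open>A\<close> are the functions in \<open>X \<rightarrow>\<^sub>E A\<close>.\<close>

definition types_over ::
    "('f, 'r) lang \<Rightarrow> ('f, 'r, 'a) struc \<Rightarrow> nat set \<Rightarrow> 'a set \<Rightarrow> ('f + 'a, 'r) fm set set" where
  "types_over L U X A =
     {p. p \<subseteq> formulas_in (lang_const L A) X \<and>
         (\<forall>q. finite q \<and> q \<subseteq> p \<longrightarrow>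
            (\<exists>b \<in> X \<rightarrow>\<^sub>E carrier U. \<forall>\<theta>\<in>q. sat (struc_const U) b \<theta>)) \<and>
         (\<forall>\<theta>\<in>formulas_in (lang_const L A) X. \<theta> \<in> p \<or> Neg \<theta> \<in> p)}"

definition tp ::
    "('f, 'r) lang \<Rightarrow> ('f, 'r, 'a) struc \<Rightarrow> nat set \<Rightarrow> (nat \<Rightarrow> 'a) \<Rightarrow> 'a set \<Rightarrow> ('f + 'a, 'r) fm set"
  where
  "tp L U X b A = {\<theta> \<in> formulas_in (lang_const L A) X. sat (struc_const U) b \<theta>}"

definition small :: "('f, 'r, 'a) struc \<Rightarrow> 'a set \<Rightarrow> bool" where
  "small U A \<longleftrightarrow> A \<subseteq> carrier U \<and> A \<prec> carrier U"

definition saturated :: "('f, 'r) lang \<Rightarrow> ('f, 'r, 'a) struc \<Rightarrow> bool" where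
  "saturated L U \<longleftrightarrow>
     (\<forall>A X p. small U A \<and> finite X \<and> p \<in> types_over L U X A \<longrightarrow>
        (\<exists>b \<in> X \<rightarrow>\<^sub>E carrier U. \<forall>\<theta>\<in>p. sat (struc_const U) b \<theta>))"

text \<open>For a countable theory, ``large'' is uncountable.\<close>

definition monster_model ::
    "('f, 'r) lang \<Rightarrow> ('f, 'r) fm set \<Rightarrow> ('f, 'r, 'a) struc \<Rightarrow> bool" where
  "monster_model L T U \<longleftrightarrow>
     is_struc L U \<and> models U T \<and> uncountable (carrier U) \<and> saturated L U"

definition elementary_substruc ::
    "('f, 'r) lang \<Rightarrow> ('f, 'r, 'a) struc \<Rightarrow> ('f, 'r, 'a) struc \<Rightarrow> bool" where
  "elementary_substruc L N U \<longleftrightarrow>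
     is_struc L N \<and> carrier N \<subseteq> carrier U \<and>
     (\<forall>f\<in>fsyms L. \<forall>as. length as = farity L f \<and> set as \<subseteq> carrier N \<longrightarrow>
        fint N f as = fint U f as) \<and>
     (\<forall>R\<in>rsyms L. \<forall>as. length as = rarity L R \<and> set as \<subseteq> carrier N \<longrightarrow>
        rint N R as = rint U R as) \<and>
     (\<forall>\<phi>\<in>formulas L. \<forall>v. range v \<subseteq> carrier N \<longrightarrow> sat N v \<phi> = sat U v \<phi>)"

text \<open>\<open>M\<close> is a model of \<open>T\<close> in the sense in which one works inside a monster model
  \<open>U\<close> of \<open>T\<close>: a small subset of \<open>U\<close> carrying an elementary substructure.\<close>

definition small_model ::
    "('f, 'r) lang \<Rightarrow> ('f, 'r) fm set \<Rightarrow> ('f, 'r, 'a) struc \<Rightarrow> 'a set \<Rightarrow> bool" where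
  "small_model L T U M \<longleftrightarrow>
     small U M \<and> models (U\<lparr>carrier := M\<rparr>) T \<and> elementary_substruc L (U\<lparr>carrier := M\<rparr>) U"


section \<open>NIP\<close>

definition shatters :: "'b set set \<Rightarrow> 'b set \<Rightarrow> bool" where
  "shatters \<F> S \<longleftrightarrow> (\<lambda>C. C \<inter> S) ` \<F> = Pow S"

definition vc_dim :: "'b set set \<Rightarrow> enat" where
  "vc_dim \<F> = (SUP S\<in>{S. finite S \<and> shatters \<F> S}. enat (card S))"

definition NIP :: "('f, 'r) lang \<Rightarrow> ('f, 'r, 'a) struc \<Rightarrow> bool" where
  "NIP L U \<longleftrightarrow>
     (\<forall>X Y \<phi>. finite X \<and> finite Y \<and> X \<inter> Y = {} \<and> \<phi> \<in> formulas_in L (X \<union> Y) \<longrightarrow>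
        vc_dim {{a \<in> X \<rightarrow>\<^sub>E carrier U. sat U (override_on a b Y) \<phi>} | b. b \<in> Y \<rightarrow>\<^sub>E carrier U} < \<infinity>)"


section \<open>Compressible types and compressible constructibility\<close>

definition implies_in ::
    "('f, 'r, 'a) struc \<Rightarrow> nat set \<Rightarrow> ('f + 'a, 'r) fm \<Rightarrow> ('f + 'a, 'r) fm set \<Rightarrow> bool" where
  "implies_in U X \<theta> \<Gamma> \<longleftrightarrow>
     (\<forall>b \<in> X \<rightarrow>\<^sub>E carrier U. sat (struc_const U) b \<theta> \<longrightarrow> (\<forall>\<gamma>\<in>\<Gamma>. sat (struc_const U) b \<gamma>))"

definition compressible ::
    "('f, 'r) lang \<Rightarrow> ('f, 'r, 'a) struc \<Rightarrow> nat set \<Rightarrow> 'a set \<Rightarrow> ('f + 'a, 'r) fm set \<Rightarrow> bool" where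
  "compressible L U X A p \<longleftrightarrow>
     p \<in> types_over L U X A \<and>
     (\<forall>Y \<phi>. finite Y \<and> X \<inter> Y = {} \<and> \<phi> \<in> formulas_in L (X \<union> Y) \<longrightarrow>
       (\<exists>Z \<psi>. finite Z \<and> X \<inter> Z = {} \<and> \<psi> \<in> formulas_in L (X \<union> Z) \<and>
         (\<forall>A0. finite A0 \<and> A0 \<subseteq> A \<longrightarrow>
           (\<exists>c \<in> Z \<rightarrow>\<^sub>E A. inst Z c \<psi> \<in> p \<and>
              implies_in U X (inst Z c \<psi>)
                ({inst Y a \<phi> | a. a \<in> Y \<rightarrow>\<^sub>E A0 \<and> inst Y a \<phi> \<in> p} \<union>
                 {Neg (inst Y a \<phi>) | a. a \<in> Y \<rightarrow>\<^sub>E A0 \<and> Neg (inst Y a \<phi>) \<in> p})))))"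

text \<open>The ordinal indexing the enumeration is given by a well-order \<open>r\<close>. Repetitions
  are allowed; since they can be dropped, well-orders on subsets of \<^typ>\<open>'a\<close> give all
  ordinals that matter.\<close>

definition compressibly_constructible ::
    "('f, 'r) lang \<Rightarrow> ('f, 'r, 'a) struc \<Rightarrow> 'a set \<Rightarrow> 'a set \<Rightarrow> bool" where
  "compressibly_constructible L U A B \<longleftrightarrow>
     (\<exists>(r :: 'a rel) b. Well_order r \<and> b ` Field r = B \<and>
        (\<forall>i\<in>Field r.
           let C = A \<union> b ` {j. (j, i) \<in> r \<and> j \<noteq> i}
           in compressible L U {0} C (tp L U {0} (\<lambda>_\<in>{0}. b i) C)))"

end

theory Submission
  imports Defs "HOL-Library.Countable_Set"
begin

text \<open>The point is that every satisfiable formula over a small \<open>C \<supseteq> F\<close> has a realization whose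
  \<open>L'\<close>-type over \<open>C\<close> is compressible. Start with the filter of solutions and treat the
  countably many \<open>L'\<close>-formulas in turn. For one formula \<open>\<phi>(x,y)\<close>, refine the filter to a
  finest proper one generated by conjunctions of at most \<open>k\<close> instances of \<open>\<plusminus>\<phi>\<close> over \<open>C\<close>; for
  suitable \<open>k\<close> this lowers the largest size of a set of parameters shattered by \<open>\<phi>\<close> along the filter.
  By NIP, finitely many refinements decide all instances of \<open>\<phi>\<close>. The intersection of the
  resulting filters is a complete type, realized by saturation, and each instance of \<open>\<phi>\<close> is decided by
  boundedly many earlier ones, which is compressibility.

  A type over \<open>C \<supseteq> F\<close> that is compressible for \<open>L'\<close> is compressible for \<open>L'(F)\<close>, since the
  constants of a formula are parameters from \<open>C\<close>. So one enumerates \<open>F\<close> first, whose elements are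
  isolated by constants, and then realizes by transfinite recursion all formulas that have parameters
  among \<open>B\<close>, \<open>F\<close> and earlier realizations; the Tarski--Vaught test gives the model.\<close>

section \<open>Filters deciding a family of tests\<close>

definition pat :: "('i \<Rightarrow> 'x \<Rightarrow> bool) \<Rightarrow> ('i \<times> bool) set \<Rightarrow> 'x \<Rightarrow> bool" where
  "pat t R x \<longleftrightarrow> (\<forall>(i, e)\<in>R. t i x = e)"

text \<open>One conjunction of at most \<open>k\<close> literals must serve each event of
  \<open>G\<close>, without intersecting several of them. This makes \<open>k\<close> a uniform
  bound that survives limits of chains.\<close>

definition based ::
    "('i \<Rightarrow> 'x \<Rightarrow> bool) \<Rightarrow> 'i set \<Rightarrow> nat \<Rightarrow> 'x filter \<Rightarrow> 'x filter \<Rightarrow> bool" where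
  "based t I k G G0 \<longleftrightarrow> G \<le> G0 \<and>
     (\<forall>P. eventually P G \<longrightarrow>
        (\<exists>R. finite R \<and> R \<subseteq> I \<times> UNIV \<and> card R \<le> k \<and> eventually (pat t R) G \<and>
             eventually (\<lambda>x. pat t R x \<longrightarrow> P x) G0))"

text \<open>Every assignment has to occur on a \<open>G\<close>-positive set, so refining
  \<open>G\<close> can only destroy shattering.\<close>

definition frequently_shatters :: "('i \<Rightarrow> 'x \<Rightarrow> bool) \<Rightarrow> 'x filter \<Rightarrow> 'i set \<Rightarrow> bool" where
  "frequently_shatters t G Z \<longleftrightarrow> (\<forall>s. frequently (\<lambda>x. \<forall>i\<in>Z. t i x = s i) G)"

text \<open>Subsets of a set shattered along \<open>G\<close> are shattered as well, so excluding
  size \<open>n\<close> excludes all larger finite sizes.\<close>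

definition shatters_below :: "('i \<Rightarrow> 'x \<Rightarrow> bool) \<Rightarrow> 'i set \<Rightarrow> 'x filter \<Rightarrow> nat \<Rightarrow> bool" where
  "shatters_below t I G n \<longleftrightarrow>
     (\<forall>Z\<subseteq>I. finite Z \<and> card Z = n \<longrightarrow> \<not> frequently_shatters t G Z)"

lemma pat_empty [simp]: "pat t {} = (\<lambda>_. True)"
  by (simp add: pat_def fun_eq_iff)

lemma pat_Un: "pat t (R \<union> S) x \<longleftrightarrow> pat t R x \<and> pat t S x"
  by (auto simp: pat_def)

lemma pat_insert: "pat t (insert (i, e) R) x \<longleftrightarrow> t i x = e \<and> pat t R x"
  by (auto simp: pat_def)

lemma pat_antimono: "R \<subseteq> S \<Longrightarrow> pat t S x \<Longrightarrow> pat t R x"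
  by (auto simp: pat_def)

lemma based_refl: "based t I k G G"
  unfolding based_def by (auto intro!: exI[of _ "{}"])

text \<open>The bounds add: that \<open>R2\<close> implies \<open>P\<close> is an event of
  \<open>G1\<close>, hence is itself forced over \<open>G0\<close> by a pattern \<open>R1\<close>,
  and \<open>R1 \<union> R2\<close> then forces \<open>P\<close>.\<close>

lemma based_trans:
  assumes "based t I k G1 G0" and "based t I l G2 G1"
  shows "based t I (k + l) G2 G0"
  unfolding based_def
proof (intro conjI allI impI)
  show "G2 \<le> G0"
    using assms by (auto simp: based_def)
  fix P assume "eventually P G2"
  then obtain R2 where R2: "finite R2" "R2 \<subseteq> I \<times> UNIV" "card R2 \<le> l" "eventually (pat t R2) G2"
      "eventually (\<lambda>x. pat t R2 x \<longrightarrow> P x) G1"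
    using assms(2) unfolding based_def by blast
  then obtain R1 where R1: "finite R1" "R1 \<subseteq> I \<times> UNIV" "card R1 \<le> k" "eventually (pat t R1) G1"
      "eventually (\<lambda>x. pat t R1 x \<longrightarrow> (pat t R2 x \<longrightarrow> P x)) G0"
    using assms(1) unfolding based_def by blast
  have "eventually (pat t R1) G2"
    using R1(4) assms(2) by (auto simp: based_def le_filter_def)
  then have "eventually (pat t (R1 \<union> R2)) G2"
    using R2(4) by eventually_elim (simp add: pat_Un)
  moreover have "eventually (\<lambda>x. pat t (R1 \<union> R2) x \<longrightarrow> P x) G0"
    using R1(5) by eventually_elim (simp add: pat_Un)
  moreover have "card (R1 \<union> R2) \<le> k + l"
    using card_Un_le[of R1 R2] R1(3) R2(3) by linarith
  ultimately show "\<exists>R. finite R \<and> R \<subseteq> I \<times> UNIV \<and> card R \<le> k + l \<and> eventually (pat t R) G2 \<and>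
      eventually (\<lambda>x. pat t R x \<longrightarrow> P x) G0"
    using R1(1,2) R2(1,2) by (intro exI[of _ "R1 \<union> R2"]) auto
qed

text \<open>Zorn's lemma applies because every event of the infimum of a chain is already an event
  of some member; the pattern witnessing it there still works, with the same bound
  \<open>k\<close>.\<close>

lemma ex_finest_based:
  fixes t :: "'i \<Rightarrow> 'x \<Rightarrow> bool"
  assumes "G0 \<noteq> bot"
  obtains G where "G \<noteq> bot" "based t I k G G0"
    "\<And>H. H \<noteq> bot \<Longrightarrow> based t I k H G0 \<Longrightarrow> H \<le> G \<Longrightarrow> H = G"
proof -
  let ?S = "{G. G \<noteq> bot \<and> based t I k G G0}"
  \<comment> \<open>Zorn's lemma produces maximal elements, so the order on filters is
    reversed.\<close>
  define le where "le = (\<lambda>G H :: 'x filter. H \<le> G)"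
  have "\<exists>m\<in>?S. \<forall>a\<in>?S. le m a \<longrightarrow> a = m"
  proof (rule predicate_Zorn)
    show "partial_order_on ?S (relation_of le ?S)"
      by (auto simp: partial_order_on_def preorder_on_def refl_on_def trans_def antisym_def
          relation_of_def le_def)
  next
    fix C assume C: "C \<in> Chains (relation_of le ?S)"
    then have CS: "C \<subseteq> ?S" and tot: "\<And>G H. G \<in> C \<Longrightarrow> H \<in> C \<Longrightarrow> G \<le> H \<or> H \<le> G"
      by (auto simp: Chains_def relation_of_def le_def)
    show "\<exists>u\<in>?S. \<forall>a\<in>C. le a u"
    proof (cases "C = {}")
      case True
      then show ?thesis using assms based_refl by blast
    next
      case False
      have ev: "eventually P (Inf C) \<longleftrightarrow> (\<exists>G\<in>C. eventually P G)" for P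
      proof -
        have "\<exists>x\<in>C. x \<le> inf G H" if "G \<in> C" "H \<in> C" for G H
          using tot[OF that] that by (metis inf.absorb1 inf.absorb2 order_refl)
        then show ?thesis
          using eventually_Inf_base[OF False, of P] by blast
      qed
      have "Inf C \<noteq> bot"
        using ev[of "\<lambda>_. False"] CS by (auto simp: trivial_limit_def)
      moreover have "based t I k (Inf C) G0"
        unfolding based_def
      proof (intro conjI allI impI)
        show "Inf C \<le> G0"
          using False CS by (auto simp: based_def intro: Inf_lower2)
        fix P assume "eventually P (Inf C)"
        then obtain G where G: "G \<in> C" "eventually P G" using ev by blast
        then have "based t I k G G0" using CS by auto
        with G obtain R where "finite R" "R \<subseteq> I \<times> UNIV" "card R \<le> k" "eventually (pat t R) G"
            "eventually (\<lambda>x. pat t R x \<longrightarrow> P x) G0"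
          unfolding based_def by blast
        with G(1) show "\<exists>R. finite R \<and> R \<subseteq> I \<times> UNIV \<and> card R \<le> k \<and> eventually (pat t R) (Inf C) \<and>
            eventually (\<lambda>x. pat t R x \<longrightarrow> P x) G0"
          using ev by blast
      qed
      ultimately show ?thesis
        by (intro bexI[of _ "Inf C"]) (auto simp: le_def intro: Inf_lower)
    qed
  qed
  then show ?thesis using that unfolding le_def by blast
qed

text \<open>If a finest \<open>k\<close>-based filter shattered a set \<open>Z\<close> of size \<open>d\<close>, then
  a pattern in it of size close to \<open>k\<close> would contain a test whose flipped value is, over the coarse
  filter, compatible with each of the \<open>2 ^ d\<close> assignments to \<open>Z\<close>: otherwise \<open>d\<close> literals
  of the pattern could be traded for an assignment to \<open>Z\<close>, giving a finer \<open>k\<close>-based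
  filter. This is the argument of Chen, Cheng and Tang for the recursive teaching dimension.\<close>

lemma frequently_conj_eventually:
  assumes "frequently Q G" and "eventually P G"
  shows "frequently (\<lambda>x. P x \<and> Q x) G"
proof (rule frequently_rev_mp[OF assms(1)])
  show "eventually (\<lambda>x. Q x \<longrightarrow> P x \<and> Q x) G"
    using assms(2) by eventually_elim simp
qed

lemma finest_based_shatters_less:
  fixes t :: "'i \<Rightarrow> 'x \<Rightarrow> bool"
  assumes G: "G \<noteq> bot" "based t I k G G0"
    and finest: "\<And>H. H \<noteq> bot \<Longrightarrow> based t I k H G0 \<Longrightarrow> H \<le> G \<Longrightarrow> H = G"
    and G0: "shatters_below t I G0 (Suc d)"
    and d: "d \<noteq> 0" and k: "k = d + 2 ^ d * d"
  shows "shatters_below t I G d"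
  unfolding shatters_below_def
proof (intro allI impI notI)
  fix Z assume Z: "Z \<subseteq> I" "finite Z \<and> card Z = d" and sh: "frequently_shatters t G Z"
  have GG0: "G \<le> G0" using G(2) by (simp add: based_def)
  define C where "C = (Z \<rightarrow>\<^sub>E (UNIV :: bool set))"
  have finC: "finite C" unfolding C_def using Z by (intro finite_PiE) auto
  have cardC: "card C = 2 ^ d" unfolding C_def using Z by (subst card_PiE) auto
  define pc where "pc = (\<lambda>(c::'i \<Rightarrow> bool) x. \<forall>i\<in>Z. t i x = c i)"
  have freqG: "frequently (pc c) G" for c
    using sh by (simp add: frequently_shatters_def pc_def)
  define cp where "cp = (\<lambda>c :: 'i \<Rightarrow> bool. (\<lambda>i. (i, c i)) ` Z)"
  have pat_cp: "pat t (cp c) = pc c" for c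
    by (auto simp: pat_def cp_def pc_def)
  have card_cp: "card (cp c) = d" and fin_cp: "finite (cp c)" and cp_sub: "cp c \<subseteq> I \<times> UNIV" for c
    using Z by (auto simp: cp_def card_image inj_on_def)
  \<comment> \<open>\<open>fails c P\<close> records an exchange: \<open>R'\<close> is part of a
    pattern holding along \<open>G\<close>, leaves room for the \<open>d\<close> literals of
    \<open>c\<close>, and together with \<open>c\<close> forces \<open>P\<close> over
    \<open>G0\<close>.\<close>
  define fails where "fails = (\<lambda>c P. \<exists>R R'. finite R \<and> R \<subseteq> I \<times> UNIV \<and> R' \<subseteq> R \<and> eventually (pat t R) G \<and>
       card R' + d \<le> k \<and> eventually (\<lambda>x. pat t R' x \<and> pc c x \<longrightarrow> P x) G0)"
  \<comment> \<open>If all events of \<open>G\<close> failed for \<open>c\<close>, adjoining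
    \<open>c\<close> to \<open>G\<close> would give a \<open>k\<close>-based filter, and by
    minimality \<open>c\<close> would already hold along \<open>G\<close>; but \<open>c\<close>
    flipped at one point of \<open>Z\<close> also occurs frequently.\<close>
  have step: "\<exists>P. eventually P G \<and> \<not> fails c P" if c: "c \<in> C" for c
  proof (rule ccontr)
    assume "\<not> ?thesis"
    then have fail: "fails c P" if "eventually P G" for P
      using that by blast
    define H where "H = inf G (principal {x. pc c x})"
    have evH: "eventually P H \<longleftrightarrow> eventually (\<lambda>x. pc c x \<longrightarrow> P x) G" for P
      by (simp add: H_def eventually_inf_principal)
    have "H \<noteq> bot"
      using freqG[of c] evH[of "\<lambda>_. False"] by (simp add: trivial_limit_def frequently_def)
    moreover have "H \<le> G" by (simp add: H_def)
    moreover have "based t I k H G0"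
      unfolding based_def
    proof (intro conjI allI impI)
      show "H \<le> G0" using GG0 \<open>H \<le> G\<close> by simp
      fix P assume "eventually P H"
      then have "fails c (\<lambda>x. pc c x \<longrightarrow> P x)"
        using fail evH by simp
      then obtain R R' where R: "finite R" "R \<subseteq> I \<times> UNIV" "R' \<subseteq> R" "eventually (pat t R) G"
         "card R' + d \<le> k" "eventually (\<lambda>x. pat t R' x \<and> pc c x \<longrightarrow> (pc c x \<longrightarrow> P x)) G0"
        unfolding fails_def by (elim exE conjE)
      have "eventually (pat t (R' \<union> cp c)) H"
        unfolding evH using R(4)
        by eventually_elim (use R(3) in \<open>auto simp: pat_Un pat_cp intro: pat_antimono\<close>)
      moreover have "eventually (\<lambda>x. pat t (R' \<union> cp c) x \<longrightarrow> P x) G0"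
        using R(6) by eventually_elim (auto simp: pat_Un pat_cp)
      moreover have "card (R' \<union> cp c) \<le> k"
        using card_Un_le[of R' "cp c"] R(5) card_cp[of c] by linarith
      moreover have "finite R'" using R finite_subset by blast
      ultimately show "\<exists>R. finite R \<and> R \<subseteq> I \<times> UNIV \<and> card R \<le> k \<and> eventually (pat t R) H \<and>
            eventually (\<lambda>x. pat t R x \<longrightarrow> P x) G0"
        using R cp_sub fin_cp by (intro exI[of _ "R' \<union> cp c"]) blast
    qed
    ultimately have "H = G" using finest by blast
    then have "eventually (pc c) G" using evH[of "pc c"] by simp
    moreover obtain z where "z \<in> Z" using d Z by fastforce
    have "frequently (pc (c(z := \<not> c z))) G" by (rule freqG)
    ultimately have "frequently (\<lambda>x. pc c x \<and> pc (c(z := \<not> c z)) x) G"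
      using frequently_conj_eventually by blast
    then obtain x where "pc c x" "pc (c(z := \<not> c z)) x"
      using frequently_ex by blast
    with \<open>z \<in> Z\<close> show False
      unfolding pc_def by (metis fun_upd_same)
  qed
  then have "\<forall>c\<in>C. \<exists>P. eventually P G \<and> \<not> fails c P"
    by blast
  then obtain S where S: "\<forall>c\<in>C. eventually (S c) G \<and> \<not> fails c (S c)"
    using bchoice by meson
  have nf: False if "c \<in> C" "R' \<subseteq> R" "card R' + d \<le> k"
    "finite R" "R \<subseteq> I \<times> UNIV" "eventually (pat t R) G"
    "eventually (\<lambda>x. pat t R' x \<and> pc c x \<longrightarrow> S c x) G0" for c R R'
  proof -
    have "fails c (S c)"
      unfolding fails_def using that by (intro exI[of _ R] exI[of _ R'] conjI)
    then show False using S that by blast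
  qed
  \<comment> \<open>There are finitely many assignments \<open>c\<close>, so a single pattern
    \<open>R\<close> can force all the events \<open>S c\<close>, none of which admits an
    exchange.\<close>
  have "eventually (\<lambda>x. \<forall>c\<in>C. S c x) G"
    using S finC by (simp add: eventually_ball_finite)
  then obtain R where R: "finite R" "R \<subseteq> I \<times> UNIV" "card R \<le> k" "eventually (pat t R) G"
      "eventually (\<lambda>x. pat t R x \<longrightarrow> (\<forall>c\<in>C. S c x)) G0"
    using G(2) unfolding based_def by blast
  \<comment> \<open>These are the literals of \<open>R\<close> forced by \<open>c\<close> over
    \<open>G0\<close>. If there were \<open>d\<close> of them, they could be replaced in
    \<open>R\<close> by \<open>c\<close>, which is an exchange for \<open>S c\<close>.\<close>
  define bad where "bad = (\<lambda>c. {(i, e) \<in> R. eventually (\<lambda>x. pc c x \<longrightarrow> t i x = e) G0})"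
  have bad_le: "card (bad c) < d" if c: "c \<in> C" for c
  proof (rule ccontr)
    assume "\<not> card (bad c) < d"
    then obtain D where D: "D \<subseteq> bad c" "card D = d"
      by (meson linorder_not_le obtain_subset_with_card_n)
    have badR: "bad c \<subseteq> R" by (auto simp: bad_def)
    then have finD: "finite D" using D R(1) by (meson finite_subset)
    have "card (R - D) + d \<le> k"
      using R(1,3) D badR finD by (metis card_Diff_subset card_mono le_add_diff_inverse2 order.trans)
    moreover have "eventually (\<lambda>x. \<forall>(i, e)\<in>D. pc c x \<longrightarrow> t i x = e) G0"
      using D(1) finD by (auto simp: eventually_ball_finite_distrib bad_def)
    then have "eventually (\<lambda>x. pat t (R - D) x \<and> pc c x \<longrightarrow> S c x) G0"
      using R(5) by eventually_elim (use c in \<open>auto simp: pat_def\<close>)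
    ultimately show False
      using nf[OF c _ _ R(1,2,4), of "R - D"] by blast
  qed
  obtain c0 where c0: "c0 \<in> C"
    using cardC by (metis card.empty ex_in_conv power_not_zero zero_neq_numeral)
  \<comment> \<open>The choice of \<open>k\<close> enters here: were \<open>R\<close> no larger than
    \<open>2 ^ d * d\<close>, it could be extended by \<open>c0\<close> without dropping anything.
    The bad literals number at most \<open>2 ^ d * d\<close>, so some literal of \<open>R\<close> is
    bad for no assignment.\<close>
  have "card R > 2 ^ d * d"
  proof (rule ccontr)
    assume "\<not> ?thesis"
    then have "card R + d \<le> k" using k by simp
    moreover have "eventually (\<lambda>x. pat t R x \<and> pc c0 x \<longrightarrow> S c0 x) G0"
      using R(5) by eventually_elim (use c0 in auto)
    ultimately show False
      using nf[OF c0 _ _ R(1,2,4), of R] by blast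
  qed
  moreover have "card (\<Union>c\<in>C. bad c) \<le> (\<Sum>c\<in>C. card (bad c))"
    using finC by (rule card_UN_le)
  moreover have "(\<Sum>c\<in>C. card (bad c)) \<le> (\<Sum>c\<in>C. d)"
    using bad_le by (intro sum_mono) (simp add: less_imp_le)
  moreover have "(\<Sum>c\<in>C. d) = 2 ^ d * d"
    by (simp add: cardC)
  ultimately have "card (\<Union>c\<in>C. bad c) < card R"
    by linarith
  moreover have "finite (\<Union>c\<in>C. bad c)"
    using R(1) by (rule finite_subset[rotated]) (auto simp: bad_def)
  ultimately have "\<not> R \<subseteq> (\<Union>c\<in>C. bad c)"
    by (meson card_mono linorder_not_le)
  then obtain i e where ie: "(i, e) \<in> R" and good: "\<And>c. c \<in> C \<Longrightarrow> (i, e) \<notin> bad c"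
    by auto
  have iG: "eventually (\<lambda>x. t i x = e) G"
    using R(4) by eventually_elim (use ie in \<open>auto simp: pat_def\<close>)
  have fr: "frequently (\<lambda>x. t i x = (\<not> e) \<and> pc c x) G0" if "c \<in> C" for c
    proof -
    have "frequently (\<lambda>x. \<not> (pc c x \<longrightarrow> t i x = e)) G0"
      using good[OF that] ie by (simp add: bad_def frequently_def)
    then show ?thesis by (rule frequently_elim1) auto
  qed
  have le: "frequently P G \<Longrightarrow> frequently P G0" for P
    using GG0 unfolding frequently_def le_filter_def by blast
  \<comment> \<open>The test \<open>i\<close> is eventually constant along \<open>G\<close>, whereas
    members of \<open>Z\<close> take both values frequently.\<close>
  have iZ: "i \<notin> Z"
  proof
    assume "i \<in> Z"
    have "frequently (pc (\<lambda>_. \<not> e)) G" by (rule freqG)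
    then have "frequently (\<lambda>x. t i x = (\<not> e)) G"
      by (rule frequently_elim1) (use \<open>i \<in> Z\<close> in \<open>auto simp: pc_def\<close>)
    with iG show False
      unfolding frequently_def by simp
  qed
  have "frequently_shatters t G0 (insert i Z)"
    unfolding frequently_shatters_def
  proof
    fix s :: "'i \<Rightarrow> bool"
    let ?c = "restrict s Z"
    have cC: "?c \<in> C" by (simp add: C_def)
    show "frequently (\<lambda>x. \<forall>j\<in>insert i Z. t j x = s j) G0"
    \<comment> \<open>The value \<open>e\<close> of \<open>i\<close> is combined with an assignment
      along \<open>G\<close>, the flipped value along \<open>G0\<close>; together they shatter
      \<open>d + 1\<close> tests over \<open>G0\<close>.\<close>
    proof (cases "s i = e")
      case True
      have "frequently (\<lambda>x. t i x = e \<and> pc s x) G"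
        using freqG[of s] iG by (rule frequently_conj_eventually)
      then have "frequently (\<lambda>x. t i x = e \<and> pc s x) G0" by (rule le)
      then show ?thesis by (rule frequently_elim1) (use True in \<open>auto simp: pc_def\<close>)
    next
      case False
      from fr[OF cC] show ?thesis
        by (rule frequently_elim1) (use False in \<open>auto simp: pc_def\<close>)
    qed
  qed
  moreover have "insert i Z \<subseteq> I" "finite (insert i Z)" "card (insert i Z) = Suc d"
    using Z iZ ie R(2) by auto
  ultimately show False
    using G0 unfolding shatters_below_def by blast
qed

text \<open>Induction on \<open>n\<close>, each finest filter lowering the bound by one. At
  \<open>1\<close> no single test takes both values frequently, so all are decided; \<open>0\<close>
  is impossible, since a proper filter shatters the empty set.\<close>

lemma ex_deciding_filter:
  assumes "G0 \<noteq> bot" and "shatters_below t I G0 n"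
  obtains G k where "G \<noteq> bot" "based t I k G G0"
    "\<And>i. i \<in> I \<Longrightarrow> \<exists>e. eventually (\<lambda>x. t i x = e) G"
proof -
  have "\<exists>G k. G \<noteq> bot \<and> based t I k G G0 \<and> (\<forall>i\<in>I. \<exists>e. eventually (\<lambda>x. t i x = e) G)"
    using assms
  proof (induction n arbitrary: G0 rule: less_induct)
    case (less n)
    consider "n = 0" | "n = 1" | d where "n = Suc d" "d \<noteq> 0"
      by (metis One_nat_def nat.exhaust)
    then show ?case
    proof cases
      case 1
      then have "\<not> frequently_shatters t G0 {}"
        using less.prems(2) unfolding shatters_below_def by auto
      then show ?thesis
        using less.prems(1) by (simp add: frequently_shatters_def)
    next
      case 2
      have "\<exists>e. eventually (\<lambda>x. t i x = e) G0" if "i \<in> I" for i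
      proof -
        have "\<not> frequently_shatters t G0 {i}"
          using less.prems(2) that 2 unfolding shatters_below_def by auto
        then obtain s where "\<not> frequently (\<lambda>x. t i x = s i) G0"
          by (auto simp: frequently_shatters_def)
        then have "eventually (\<lambda>x. t i x = (\<not> s i)) G0"
          unfolding frequently_def by (simp add: eventually_mono)
        then show ?thesis by blast
      qed
      then show ?thesis
        using less.prems(1) based_refl by blast
    next
      case (3 d)
      obtain G where G: "G \<noteq> bot" "based t I (d + 2 ^ d * d) G G0"
        "\<And>H. H \<noteq> bot \<Longrightarrow> based t I (d + 2 ^ d * d) H G0 \<Longrightarrow> H \<le> G \<Longrightarrow> H = G"
        using ex_finest_based[OF less.prems(1)] by blast
      have "shatters_below t I G d"
        using less.prems(2) 3 by (intro finest_based_shatters_less[OF G _ _ refl]) auto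
      then obtain H l where H: "H \<noteq> bot" "based t I l H G"
          "\<forall>i\<in>I. \<exists>e. eventually (\<lambda>x. t i x = e) H"
        using less.IH[of d G] 3 G(1) by auto
      then show ?thesis
        using based_trans[OF G(2) H(2)] by blast
    qed
  qed
  then show ?thesis using that by blast
qed

section \<open>Renaming variables and eliminating constants\<close>

lemma eval_cong: "(\<And>x. x \<in> fv_tm t \<Longrightarrow> v x = w x) \<Longrightarrow> eval U v t = eval U w t"
proof (induction t)
  case (Fun g ts)
  then have "map (eval U v) ts = map (eval U w) ts"
    by (intro map_cong refl Fun.IH) auto
  then show ?case by (simp only: eval.simps)
qed simp

lemma sat_cong: "(\<And>x. x \<in> fv \<phi> \<Longrightarrow> v x = w x) \<Longrightarrow> sat U v \<phi> \<longleftrightarrow> sat U w \<phi>"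
proof (induction \<phi> arbitrary: v w)
  case (Eq s t)
  then show ?case using eval_cong[of s v w U] eval_cong[of t v w U] by simp
next
  case (Rel R ts)
  then have "map (eval U v) ts = map (eval U w) ts"
    by (intro map_cong refl eval_cong) auto
  then show ?case by (simp only: sat.simps)
next
  case (Neg \<phi>)
  have "sat U v \<phi> \<longleftrightarrow> sat U w \<phi>"
    using Neg.prems by (intro Neg.IH) auto
  then show ?case by simp
next
  case (Conj \<phi>1 \<phi>2)
  have "sat U v \<phi>1 \<longleftrightarrow> sat U w \<phi>1" "sat U v \<phi>2 \<longleftrightarrow> sat U w \<phi>2"
    using Conj.prems by (auto intro!: Conj.IH)
  then show ?case by simp
next
  case (Exists x \<phi>)
  have "sat U (v(x := a)) \<phi> \<longleftrightarrow> sat U (w(x := a)) \<phi>" for a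
    using Exists.prems by (intro Exists.IH) auto
  then show ?case by simp
qed

lemma finite_fv_tm: "finite (fv_tm t)"
  by (induction t) auto

lemma finite_fv [simp]: "finite (fv \<phi>)"
  by (induction \<phi>) (auto simp: finite_fv_tm)

section \<open>Renaming of variables\<close>

primrec rename_tm :: "(nat \<Rightarrow> nat) \<Rightarrow> 'f tm \<Rightarrow> 'f tm" where
  "rename_tm f (Var x) = Var (f x)"
| "rename_tm f (Fun g ts) = Fun g (map (rename_tm f) ts)"

text \<open>Bound variables are renamed too; injectivity of \<open>f\<close> then excludes
  capture.\<close>

primrec rename :: "(nat \<Rightarrow> nat) \<Rightarrow> ('f, 'r) fm \<Rightarrow> ('f, 'r) fm" where
  "rename f (Eq s t) = Eq (rename_tm f s) (rename_tm f t)"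
| "rename f (Rel R ts) = Rel R (map (rename_tm f) ts)"
| "rename f (Neg \<phi>) = Neg (rename f \<phi>)"
| "rename f (Conj \<phi> \<psi>) = Conj (rename f \<phi>) (rename f \<psi>)"
| "rename f (Exists x \<phi>) = Exists (f x) (rename f \<phi>)"

lemma fv_rename_tm: "fv_tm (rename_tm f t) = f ` fv_tm t"
  by (induction t) auto

lemma fv_rename: "inj f \<Longrightarrow> fv (rename f \<phi>) = f ` fv \<phi>"
  by (induction \<phi>) (auto simp: fv_rename_tm dest: injD)

lemma wf_rename_tm [simp]: "wf_tm L (rename_tm f t) = wf_tm L t"
  by (induction t) auto

lemma wf_rename [simp]: "wf_fm L (rename f \<phi>) = wf_fm L \<phi>"
  by (induction \<phi>) auto

lemma eval_rename_tm: "eval U v (rename_tm f t) = eval U (v \<circ> f) t"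
  by (induction t) (auto intro!: arg_cong[where f = "fint U _"])

lemma sat_rename: "inj f \<Longrightarrow> sat U v (rename f \<phi>) \<longleftrightarrow> sat U (v \<circ> f) \<phi>"
proof (induction \<phi> arbitrary: v)
  case (Rel R ts)
  have "map (eval U v \<circ> rename_tm f) ts = map (eval U (v \<circ> f)) ts"
    by (simp add: eval_rename_tm)
  then show ?case by (simp only: sat.simps rename.simps list.map_comp)
next
  case (Exists x \<phi>)
  have "v(f x := a) \<circ> f = (v \<circ> f)(x := a)" for a
    using Exists.prems by (auto simp: fun_eq_iff dest: injD)
  then show ?case using Exists by (simp only: rename.simps sat.simps)
qed (simp_all add: eval_rename_tm)

text \<open>In \<open>conj_apart \<phi> \<psi>\<close> the variable \<open>0\<close> is shared and all other variables of
  \<open>\<phi>\<close> and \<open>\<psi>\<close> are made disjoint.\<close>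

definition conj_apart :: "('f, 'r) fm \<Rightarrow> ('f, 'r) fm \<Rightarrow> ('f, 'r) fm" where
  "conj_apart \<phi> \<psi> = Conj (rename (\<lambda>x. 2 * x) \<phi>) (rename (\<lambda>x. 2 * x - 1) \<psi>)"

text \<open>The assignment matching \<open>conj_apart\<close>: even positions read \<open>c\<close>,
  and the odd position \<open>2 * n - 1\<close> reads \<open>d n\<close> for
  \<open>n \<ge> 1\<close>. Position \<open>0\<close> belongs to \<open>c\<close>.\<close>

definition join :: "(nat \<Rightarrow> 'a) \<Rightarrow> (nat \<Rightarrow> 'a) \<Rightarrow> nat \<Rightarrow> 'a" where
  "join c d n = (if even n then c (n div 2) else d (Suc n div 2))"

lemma inj_double: "inj (\<lambda>x :: nat. 2 * x)"
  by (auto simp: inj_def)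

lemma inj_double_pred: "inj (\<lambda>x :: nat. 2 * x - 1)"
proof (rule injI)
  fix x y :: nat assume "2 * x - 1 = 2 * y - 1"
  then show "x = y" by (cases x; cases y) auto
qed

lemma wf_conj_apart [simp]: "wf_fm L (conj_apart \<phi> \<psi>) \<longleftrightarrow> wf_fm L \<phi> \<and> wf_fm L \<psi>"
  by (simp add: conj_apart_def)

lemma fv_conj_apart: "fv (conj_apart \<phi> \<psi>) = (\<lambda>x. 2 * x) ` fv \<phi> \<union> (\<lambda>x. 2 * x - 1) ` fv \<psi>"
  by (simp only: conj_apart_def fv.simps fv_rename inj_double inj_double_pred)

lemma join_even [simp]: "join c d (2 * n) = c n"
  by (simp add: join_def)

lemma join_odd [simp]: "join c d (Suc (2 * n)) = d (Suc n)"
  by (simp add: join_def)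

lemma join_upd_even: "(join c d)(2 * n := a) = join (c(n := a)) d"
  by (auto simp: join_def fun_eq_iff)

lemma join_params:
  assumes "c ` (fv \<phi> - {0}) \<subseteq> C" and "d ` (fv \<psi> - {0}) \<subseteq> C"
  shows "join c d ` (fv (conj_apart \<phi> \<psi>) - {0}) \<subseteq> C"
proof -
  have "join c d (2 * n - 1) = d n" if "n \<noteq> 0" for n
    using that by (cases n) auto
  then have "join c d (2 * n - 1) \<in> C" if "n \<in> fv \<psi>" "2 * n - 1 \<noteq> 0" for n
    using that assms(2) by (cases "n = 0") auto
  moreover have "join c d (2 * n) \<in> C" if "n \<in> fv \<phi>" "2 * n \<noteq> 0" for n
    using that assms(1) by auto
  ultimately show ?thesis
    unfolding fv_conj_apart by blast
qed

lemma sat_conj_apart: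
  "sat U ((join c d)(0 := b)) (conj_apart \<phi> \<psi>) \<longleftrightarrow> sat U (c(0 := b)) \<phi> \<and> sat U (d(0 := b)) \<psi>"
proof -
  have "((join c d)(0 := b)) \<circ> (\<lambda>x. 2 * x) = c(0 := b)"
    by (auto simp: fun_eq_iff)
  moreover have "((join c d)(0 := b)) \<circ> (\<lambda>x. 2 * x - 1) = d(0 := b)"
  proof
    fix n show "(((join c d)(0 := b)) \<circ> (\<lambda>x. 2 * x - 1)) n = (d(0 := b)) n"
      by (cases n) auto
  qed
  ultimately show ?thesis
    by (simp only: conj_apart_def sat.simps sat_rename inj_double inj_double_pred)
qed

section \<open>Trading constants for parameters\<close>

text \<open>All variables, bound ones included, move to even positions, so the odd positions that
  replace the constants are never captured by a quantifier.\<close>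

primrec unconst_tm :: "('a \<Rightarrow> nat) \<Rightarrow> ('f + 'a) tm \<Rightarrow> 'f tm" where
  "unconst_tm k (Var x) = Var (2 * x)"
| "unconst_tm k (Fun g ts) =
     (case g of Inl f \<Rightarrow> Fun f (map (unconst_tm k) ts) | Inr a \<Rightarrow> Var (Suc (2 * k a)))"

primrec unconst :: "('a \<Rightarrow> nat) \<Rightarrow> ('f + 'a, 'r) fm \<Rightarrow> ('f, 'r) fm" where
  "unconst k (Eq s t) = Eq (unconst_tm k s) (unconst_tm k t)"
| "unconst k (Rel R ts) = Rel R (map (unconst_tm k) ts)"
| "unconst k (Neg \<phi>) = Neg (unconst k \<phi>)"
| "unconst k (Conj \<phi> \<psi>) = Conj (unconst k \<phi>) (unconst k \<psi>)"
| "unconst k (Exists x \<phi>) = Exists (2 * x) (unconst k \<phi>)"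

primrec consts_tm :: "('f + 'a) tm \<Rightarrow> 'a set" where
  "consts_tm (Var x) = {}"
| "consts_tm (Fun g ts) = (case g of Inl f \<Rightarrow> {} | Inr a \<Rightarrow> {a}) \<union> \<Union> (set (map consts_tm ts))"

primrec consts_fm :: "('f + 'a, 'r) fm \<Rightarrow> 'a set" where
  "consts_fm (Eq s t) = consts_tm s \<union> consts_tm t"
| "consts_fm (Rel R ts) = \<Union> (set (map consts_tm ts))"
| "consts_fm (Neg \<phi>) = consts_fm \<phi>"
| "consts_fm (Conj \<phi> \<psi>) = consts_fm \<phi> \<union> consts_fm \<psi>"
| "consts_fm (Exists x \<phi>) = consts_fm \<phi>"

lemma finite_consts_tm: "finite (consts_tm t)"
  by (induction t) (auto split: sum.split)

lemma finite_consts_fm: "finite (consts_fm \<phi>)"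
  by (induction \<phi>) (auto simp: finite_consts_tm)

lemma consts_tm_subset: "wf_tm (lang_const L C) t \<Longrightarrow> consts_tm t \<subseteq> C"
  by (induction t) (auto simp: lang_const_def split: sum.splits)

lemma consts_fm_subset: "wf_fm (lang_const L C) \<phi> \<Longrightarrow> consts_fm \<phi> \<subseteq> C"
proof (induction \<phi>)
  case (Rel R ts)
  then show ?case using consts_tm_subset[of L C] by fastforce
qed (use consts_tm_subset[of L C] in auto)

lemma wf_unconst_tm: "wf_tm (lang_const L C) t \<Longrightarrow> wf_tm L (unconst_tm k t)"
  by (induction t) (auto simp: lang_const_def split: sum.splits)

lemma wf_unconst: "wf_fm (lang_const L C) \<phi> \<Longrightarrow> wf_fm L (unconst k \<phi>)"
proof (induction \<phi>)
  case (Rel R ts)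
  then show ?case using wf_unconst_tm[of L C] by (auto simp: lang_const_def)
qed (auto simp: wf_unconst_tm)

lemma fv_unconst_tm:
  "fv_tm (unconst_tm k t) \<subseteq> (\<lambda>x. 2 * x) ` fv_tm t \<union> (\<lambda>a. Suc (2 * k a)) ` consts_tm t"
proof (induction t)
  case (Fun g ts)
  show ?case
  proof (cases g)
    case (Inl f)
    have "fv_tm (unconst_tm k t) \<subseteq>
        (\<lambda>x. 2 * x) ` fv_tm (Fun g ts) \<union> (\<lambda>a. Suc (2 * k a)) ` consts_tm (Fun g ts)"
      if "t \<in> set ts" for t
      by (rule order.trans[OF Fun.IH[OF that]]) (use that in auto)
    then show ?thesis using Inl by (simp only: unconst_tm.simps sum.case fv_tm.simps) auto
  qed simp
qed simp

lemma fv_unconst: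
  "fv (unconst k \<phi>) \<subseteq> (\<lambda>x. 2 * x) ` fv \<phi> \<union> (\<lambda>a. Suc (2 * k a)) ` consts_fm \<phi>"
proof (induction \<phi>)
  case (Eq s t)
  then show ?case using fv_unconst_tm[of k s] fv_unconst_tm[of k t] by auto
next
  case (Rel R ts)
  have "fv_tm (unconst_tm k t) \<subseteq> (\<lambda>x. 2 * x) ` fv (Rel R ts) \<union> (\<lambda>a. Suc (2 * k a)) ` consts_fm (Rel R ts)"
    if "t \<in> set ts" for t
    by (rule order.trans[OF fv_unconst_tm]) (use that in auto)
  then show ?case by auto
qed auto

lemma eval_unconst_tm:
  "(\<And>a. a \<in> consts_tm t \<Longrightarrow> c (Suc (k a)) = a) \<Longrightarrow>
     eval (struc_const U) v t = eval U (join v c) (unconst_tm k t)"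
proof (induction t)
  case (Fun g ts)
  show ?case
  proof (cases g)
    case (Inl f)
    then have "map (eval (struc_const U) v) ts = map (eval U (join v c) \<circ> unconst_tm k) ts"
      using Fun by (auto simp: comp_def)
    then have "fint U f (map (eval (struc_const U) v) ts) =
        fint U f (map (eval U (join v c)) (map (unconst_tm k) ts))"
      by (simp only: list.map_comp)
    then show ?thesis using Inl
      by (simp only: eval.simps unconst_tm.simps sum.case) (simp add: struc_const_def)
  next
    case (Inr a)
    then show ?thesis using Fun.prems[of a] by (simp add: struc_const_def)
  qed
qed simp

lemma sat_unconst:
  "(\<And>a. a \<in> consts_fm \<phi> \<Longrightarrow> c (Suc (k a)) = a) \<Longrightarrow>
     sat (struc_const U) v \<phi> \<longleftrightarrow> sat U (join v c) (unconst k \<phi>)"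
proof (induction \<phi> arbitrary: v)
  case (Eq s t)
  then show ?case using eval_unconst_tm[of s c k U v] eval_unconst_tm[of t c k U v] by simp
next
  case (Rel R ts)
  have "eval (struc_const U) v t = eval U (join v c) (unconst_tm k t)" if "t \<in> set ts" for t
    using Rel that by (intro eval_unconst_tm) auto
  then have "map (eval (struc_const U) v) ts = map (eval U (join v c)) (map (unconst_tm k) ts)"
    by simp
  then show ?case
    by (simp only: sat.simps unconst.simps) (simp add: struc_const_def)
next
  case (Exists x \<phi>)
  then show ?case
    by (simp add: join_upd_even) (simp add: struc_const_def)
qed simp_all

text \<open>Only finitely many constants occur in \<open>\<theta>\<close>; once numbered they become
  parameters at odd positions. This reduces formulas over \<open>C\<close>, and formulas of the
  language naming \<open>F\<close>, to formulas of \<open>L\<close>.\<close>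

lemma ex_unconst:
  assumes "wf_fm (lang_const L C) \<theta>"
  obtains \<phi> c where "wf_fm L \<phi>" "\<And>x. 2 * x \<in> fv \<phi> \<Longrightarrow> x \<in> fv \<theta>" "\<And>x. Suc (2 * x) \<in> fv \<phi> \<Longrightarrow> c (Suc x) \<in> C"
    "\<And>v. sat (struc_const U) v \<theta> \<longleftrightarrow> sat U (join v c) \<phi>"
proof
  let ?S = "consts_fm \<theta>"
  \<comment> \<open>\<open>join\<close> reads index \<open>n + 1\<close> of its second argument at
    position \<open>2 * n + 1\<close>, whence the shift by one.\<close>
  let ?k = "to_nat_on ?S" and ?c = "\<lambda>n. from_nat_into ?S (n - 1)"
  have c: "?c (Suc (?k a)) = a" if "a \<in> ?S" for a
    using that countable_finite[OF finite_consts_fm, of \<theta>] by simp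
  show "wf_fm L (unconst ?k \<theta>)"
    using assms by (rule wf_unconst)
  show "x \<in> fv \<theta>" if "2 * x \<in> fv (unconst ?k \<theta>)" for x
  proof -
    have "2 * x \<noteq> Suc (2 * y)" for y by presburger
    moreover have "2 * x \<in> (\<lambda>x. 2 * x) ` fv \<theta> \<union> (\<lambda>a. Suc (2 * ?k a)) ` ?S"
      using that fv_unconst by (rule subsetD[rotated])
    ultimately show ?thesis by auto
  qed
  show "?c (Suc x) \<in> C" if x: "Suc (2 * x) \<in> fv (unconst ?k \<theta>)" for x
  proof -
    have "Suc (2 * x) \<noteq> 2 * y" for y by presburger
    moreover have "Suc (2 * x) \<in> (\<lambda>x. 2 * x) ` fv \<theta> \<union> (\<lambda>a. Suc (2 * ?k a)) ` ?S"
      using x fv_unconst by (rule subsetD[rotated])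
    ultimately obtain a where "a \<in> ?S" "x = ?k a" by auto
    then show ?thesis using c consts_fm_subset[OF assms] by auto
  qed
  show "sat (struc_const U) v \<theta> \<longleftrightarrow> sat U (join v ?c) (unconst ?k \<theta>)" for v
    using c by (intro sat_unconst) auto
qed

lemma fv_inst_tm: "fv_tm (inst_tm Y a t) = fv_tm t - Y"
  by (induction t) auto

lemma fv_inst [simp]: "fv (inst Y a \<phi>) = fv \<phi> - Y"
  by (induction \<phi> arbitrary: Y) (auto simp: fv_inst_tm)

lemma wf_inst_tm:
  "wf_tm L t \<Longrightarrow> a ` (Y \<inter> fv_tm t) \<subseteq> A \<Longrightarrow> wf_tm (lang_const L A) (inst_tm Y a t)"
proof (induction t)
  case (Fun g ts)
  have "a ` (Y \<inter> fv_tm t) \<subseteq> A" if "t \<in> set ts" for t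
    using Fun.prems(2) that by auto
  then show ?case
    using Fun.IH Fun.prems(1) by (auto simp: lang_const_def)
qed (auto simp: lang_const_def)

lemma wf_inst: "wf_fm L \<phi> \<Longrightarrow> a ` (Y \<inter> fv \<phi>) \<subseteq> A \<Longrightarrow> wf_fm (lang_const L A) (inst Y a \<phi>)"
proof (induction \<phi> arbitrary: Y)
  case (Eq s t)
  then show ?case by (auto intro!: wf_inst_tm)
next
  case (Rel R ts)
  have "a ` (Y \<inter> fv_tm t) \<subseteq> A" if "t \<in> set ts" for t
    using Rel.prems(2) that by auto
  then have "\<forall>t\<in>set ts. wf_tm (lang_const L A) (inst_tm Y a t)"
    using Rel.prems(1) by (auto intro!: wf_inst_tm)
  then show ?case using Rel.prems(1) by (auto simp: lang_const_def)
next
  case (Conj \<phi>1 \<phi>2)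
  have "a ` (Y \<inter> fv \<phi>1) \<subseteq> A" "a ` (Y \<inter> fv \<phi>2) \<subseteq> A"
    using Conj.prems(2) by auto
  then show ?case using Conj by simp
next
  case (Exists x \<phi>)
  have "a ` ((Y - {x}) \<inter> fv \<phi>) \<subseteq> A"
    using Exists.prems(2) by auto
  then show ?case using Exists by simp
qed simp

section \<open>Realizing a formula by an element with a compressible type\<close>

text \<open>Implying all literals over \<open>A0\<close> in the type of \<open>b\<close> amounts to
  agreeing with \<open>b\<close> on every instance of \<open>\<phi>\<close> over \<open>A0\<close>.
  The formula \<open>\<psi>\<close> is fixed before \<open>A0\<close>; only \<open>c\<close> depends
  on it.\<close>

definition compresses ::
    "('f, 'r, 'a) struc \<Rightarrow> 'a set \<Rightarrow> 'a \<Rightarrow> ('f, 'r) fm \<Rightarrow> ('f, 'r) fm \<Rightarrow> bool" where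
  "compresses U C b \<phi> \<psi> \<longleftrightarrow>
     (\<forall>A0\<subseteq>C. finite A0 \<longrightarrow>
        (\<exists>c. c ` (fv \<psi> - {0}) \<subseteq> C \<and> sat U (c(0 := b)) \<psi> \<and>
           (\<forall>x\<in>carrier U. sat U (c(0 := x)) \<psi> \<longrightarrow>
              (\<forall>a. a ` (fv \<phi> - {0}) \<subseteq> A0 \<longrightarrow> sat U (a(0 := x)) \<phi> = sat U (a(0 := b)) \<phi>))))"

definition compressible_elem ::
    "('f, 'r) lang \<Rightarrow> ('f, 'r, 'a) struc \<Rightarrow> 'a set \<Rightarrow> 'a \<Rightarrow> bool" where
  "compressible_elem L U C b \<longleftrightarrow> (\<forall>\<phi>\<in>formulas L. \<exists>\<psi>\<in>formulas L. compresses U C b \<phi> \<psi>)"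

text \<open>The variable \<open>0\<close> plays the part of \<open>x\<close> in \<open>\<phi>(x,y)\<close>.\<close>

definition test :: "('f, 'r, 'a) struc \<Rightarrow> ('f, 'r) fm \<Rightarrow> (nat \<Rightarrow> 'a) \<Rightarrow> 'a \<Rightarrow> bool" where
  "test U \<phi> a b \<longleftrightarrow> sat U (a(0 := b)) \<phi>"

text \<open>Extensional functions, so that finitely many parameters give finitely many
  tests.\<close>

definition params :: "('f, 'r) fm \<Rightarrow> 'a set \<Rightarrow> (nat \<Rightarrow> 'a) set" where
  "params \<phi> C = (fv \<phi> - {0}) \<rightarrow>\<^sub>E C"

lemma finite_params: "finite A \<Longrightarrow> finite (params \<phi> A)"
  unfolding params_def by (intro finite_PiE) auto

lemma test_restrict: "test U \<phi> (restrict a (fv \<phi> - {0})) b \<longleftrightarrow> test U \<phi> a b"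
  unfolding test_def by (intro sat_cong) auto

text \<open>NIP is applied with the variables exchanged: an element \<open>x\<close> is the
  parameter that cuts out a subset of a set of tests. An assignment frequent along \<open>G\<close>
  occurs at a point of the carrier, so frequent shattering is actual shattering. The bound is
  uniform in \<open>G\<close> and \<open>C\<close>, hence usable after earlier refinements.\<close>

lemma NIP_shatters_below:
  assumes "NIP L U" and "\<phi> \<in> formulas L"
  obtains n where "\<And>G C. C \<subseteq> carrier U \<Longrightarrow> eventually (\<lambda>b. b \<in> carrier U) G \<Longrightarrow>
    shatters_below (test U \<phi>) (params \<phi> C) G n"
proof -
  let ?X = "fv \<phi> - {0}"
  let ?F = "{{a \<in> ?X \<rightarrow>\<^sub>E carrier U. sat U (override_on a b {0}) \<phi>} | b. b \<in> {0} \<rightarrow>\<^sub>E carrier U}"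
  have "\<phi> \<in> formulas_in L (?X \<union> {0})"
    using assms(2) by (auto simp: formulas_in_def)
  then have "vc_dim ?F < \<infinity>"
    using assms(1)[unfolded NIP_def, rule_format, of ?X "{0}" \<phi>] by auto
  then obtain N where N: "vc_dim ?F = enat N"
    by (auto simp: less_infinityE)
  have "shatters_below (test U \<phi>) (params \<phi> C) G (Suc N)"
    if C: "C \<subseteq> carrier U" and G: "eventually (\<lambda>b. b \<in> carrier U) G" for G C
    unfolding shatters_below_def
  proof (intro allI impI notI)
    fix Z assume Z: "Z \<subseteq> params \<phi> C" "finite Z \<and> card Z = Suc N"
      and sh: "frequently_shatters (test U \<phi>) G Z"
    have ZX: "Z \<subseteq> ?X \<rightarrow>\<^sub>E carrier U"
      using Z(1) C unfolding params_def by (meson PiE_mono order.trans)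
    have "shatters ?F Z"
      unfolding shatters_def
    proof (intro equalityI subsetI)
      fix S assume "S \<in> Pow Z"
      then have SZ: "S \<subseteq> Z" by simp
      have "frequently (\<lambda>x. \<forall>i\<in>Z. test U \<phi> i x = (i \<in> S)) G"
        using sh[unfolded frequently_shatters_def, rule_format, of "\<lambda>i. i \<in> S"] .
      then have "frequently (\<lambda>x. x \<in> carrier U \<and> (\<forall>i\<in>Z. test U \<phi> i x = (i \<in> S))) G"
        using G by (rule frequently_conj_eventually)
      then obtain b where b: "b \<in> carrier U" "\<forall>i\<in>Z. test U \<phi> i b = (i \<in> S)"
        by (auto dest: frequently_ex)
      let ?b = "\<lambda>_\<in>{0}. b"
      have ov: "override_on a ?b {0} = a(0 := b)" for a
        by (auto simp: override_on_def)
      then have "{a \<in> ?X \<rightarrow>\<^sub>E carrier U. sat U (override_on a ?b {0}) \<phi>} \<inter> Z = S"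
        using b(2) SZ ZX unfolding ov test_def by auto
      moreover have "?b \<in> {0} \<rightarrow>\<^sub>E carrier U"
        using b(1) by simp
      ultimately show "S \<in> (\<lambda>C. C \<inter> Z) ` ?F"
        by blast
    qed auto
    then have "enat (card Z) \<le> vc_dim ?F"
      unfolding vc_dim_def using Z(2) by (intro SUP_upper) simp
    then show False
      using N Z(2) by simp
  qed
  then show ?thesis using that by blast
qed

text \<open>The filters built below have a base of sets defined over \<open>C\<close> by finitely many formulas.
  Finiteness makes a pigeonhole argument choose the single formula that compressibility asks for.\<close>

definition finitely_based ::
    "('f, 'r) lang \<Rightarrow> ('f, 'r, 'a) struc \<Rightarrow> 'a set \<Rightarrow> 'a filter \<Rightarrow> bool" where
  "finitely_based L U C G \<longleftrightarrow>
     (\<exists>\<Psi>\<subseteq>formulas L. finite \<Psi> \<and>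
       (\<forall>P. eventually P G \<longrightarrow>
         (\<exists>\<psi>\<in>\<Psi>. \<exists>c. c ` (fv \<psi> - {0}) \<subseteq> C \<and> eventually (test U \<psi> c) G \<and>
            (\<forall>x\<in>carrier U. test U \<psi> c x \<longrightarrow> P x))))"

lemma finitely_based_principal:
  assumes "\<theta> \<in> formulas L" and "d ` (fv \<theta> - {0}) \<subseteq> C"
  shows "finitely_based L U C (principal {x \<in> carrier U. test U \<theta> d x})"
  unfolding finitely_based_def
  using assms by (intro exI[of _ "{\<theta>}"]) (auto simp: eventually_principal)

section \<open>Finite bases under refinement\<close>

text \<open>These are the shapes of conjunctions of at most \<open>k\<close> literals
  \<open>\<plusminus>\<phi>\<close> with a member of \<open>\<Psi>\<close>. Parameters stay in the
  assignment, so finitely many formulas serve infinitely many patterns.\<close>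

primrec add_literals :: "('f, 'r) fm \<Rightarrow> ('f, 'r) fm set \<Rightarrow> nat \<Rightarrow> ('f, 'r) fm set" where
  "add_literals \<phi> \<Psi> 0 = \<Psi>"
| "add_literals \<phi> \<Psi> (Suc k) = add_literals \<phi> \<Psi> k \<union>
     conj_apart \<phi> ` add_literals \<phi> \<Psi> k \<union> conj_apart (Neg \<phi>) ` add_literals \<phi> \<Psi> k"

lemma finite_add_literals: "finite \<Psi> \<Longrightarrow> finite (add_literals \<phi> \<Psi> k)"
  by (induction k) auto

lemma add_literals_formulas:
  "\<phi> \<in> formulas L \<Longrightarrow> \<Psi> \<subseteq> formulas L \<Longrightarrow> add_literals \<phi> \<Psi> k \<subseteq> formulas L"
  by (induction k) (auto simp: formulas_def)

lemma add_literals_mono: "k \<le> l \<Longrightarrow> add_literals \<phi> \<Psi> k \<subseteq> add_literals \<phi> \<Psi> l"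
  by (induction l) (auto simp: le_Suc_eq)

lemma add_literals_pattern:
  assumes "finite R" and "R \<subseteq> params \<phi> C \<times> UNIV" and "\<psi> \<in> \<Psi>" and "c ` (fv \<psi> - {0}) \<subseteq> C"
  shows "\<exists>\<chi>\<in>add_literals \<phi> \<Psi> (card R). \<exists>d. d ` (fv \<chi> - {0}) \<subseteq> C \<and>
    (\<forall>x. test U \<chi> d x \<longleftrightarrow> pat (test U \<phi>) R x \<and> test U \<psi> c x)"
  using assms(1,2)
proof (induction R rule: finite_induct)
  case empty
  then show ?case using assms(3,4) by auto
next
  case (insert z R)
  obtain a e where z: "z = (a, e)" by force
  obtain \<chi> d where \<chi>: "\<chi> \<in> add_literals \<phi> \<Psi> (card R)" "d ` (fv \<chi> - {0}) \<subseteq> C"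
    "\<And>x. test U \<chi> d x \<longleftrightarrow> pat (test U \<phi>) R x \<and> test U \<psi> c x"
    using insert by auto
  let ?l = "if e then \<phi> else Neg \<phi>"
  have "a ` (fv ?l - {0}) \<subseteq> C"
    using insert.prems z by (auto simp: params_def)
  then have "join a d ` (fv (conj_apart ?l \<chi>) - {0}) \<subseteq> C"
    using \<chi>(2) by (rule join_params)
  moreover have "test U (conj_apart ?l \<chi>) (join a d) x \<longleftrightarrow>
      pat (test U \<phi>) (insert z R) x \<and> test U \<psi> c x" for x
    using \<chi>(3)[of x] z by (auto simp: test_def sat_conj_apart pat_insert)
  moreover have "conj_apart ?l \<chi> \<in> add_literals \<phi> \<Psi> (card (insert z R))"
    using \<chi>(1) insert.hyps by auto
  ultimately show ?case by blast
qed

text \<open>That a pattern forces \<open>P\<close> is an event of \<open>G0\<close>, so it contains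
  a basic set of \<open>G0\<close>; conjoining the pattern to the formula of that set gives a basic
  set of \<open>G\<close> inside \<open>P\<close>.\<close>

lemma finitely_based_step:
  assumes G0: "finitely_based L U C G0" and G: "based (test U \<phi>) (params \<phi> C) k G G0"
    and \<phi>: "\<phi> \<in> formulas L"
  shows "finitely_based L U C G"
proof -
  obtain \<Psi> where \<Psi>: "\<Psi> \<subseteq> formulas L" "finite \<Psi>"
    and \<Psi>': "\<And>P. eventually P G0 \<Longrightarrow>
         (\<exists>\<psi>\<in>\<Psi>. \<exists>c. c ` (fv \<psi> - {0}) \<subseteq> C \<and> eventually (test U \<psi> c) G0 \<and>
            (\<forall>x\<in>carrier U. test U \<psi> c x \<longrightarrow> P x))"
    using G0 unfolding finitely_based_def by metis
  have "\<exists>\<chi>\<in>add_literals \<phi> \<Psi> k. \<exists>d. d ` (fv \<chi> - {0}) \<subseteq> C \<and> eventually (test U \<chi> d) G \<and>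
      (\<forall>x\<in>carrier U. test U \<chi> d x \<longrightarrow> P x)" if ev: "eventually P G" for P
  proof -
    obtain R where R: "finite R" "R \<subseteq> params \<phi> C \<times> UNIV" "card R \<le> k"
      "eventually (pat (test U \<phi>) R) G" "eventually (\<lambda>x. pat (test U \<phi>) R x \<longrightarrow> P x) G0"
      using G[unfolded based_def, THEN conjunct2, rule_format, OF ev] by (elim exE conjE)
    obtain \<psi> c where \<psi>: "\<psi> \<in> \<Psi>" "c ` (fv \<psi> - {0}) \<subseteq> C" "eventually (test U \<psi> c) G0"
       "\<forall>x\<in>carrier U. test U \<psi> c x \<longrightarrow> (pat (test U \<phi>) R x \<longrightarrow> P x)"
      using \<Psi>'[OF R(5)] by (elim bexE exE conjE)
    obtain \<chi> d where \<chi>: "\<chi> \<in> add_literals \<phi> \<Psi> (card R)" "d ` (fv \<chi> - {0}) \<subseteq> C"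
      "\<And>x. test U \<chi> d x \<longleftrightarrow> pat (test U \<phi>) R x \<and> test U \<psi> c x"
      using add_literals_pattern[OF R(1,2) \<psi>(1,2), of U] by blast
    have "eventually (test U \<psi> c) G"
      using \<psi>(3) G by (auto simp: based_def le_filter_def)
    then have "eventually (test U \<chi> d) G"
      using R(4) by eventually_elim (simp add: \<chi>(3))
    moreover have "\<forall>x\<in>carrier U. test U \<chi> d x \<longrightarrow> P x"
      using \<psi>(4) \<chi>(3) by blast
    moreover have "\<chi> \<in> add_literals \<phi> \<Psi> k"
      using \<chi>(1) add_literals_mono[OF R(3)] by blast
    ultimately show ?thesis using \<chi>(2) by blast
  qed
  then show ?thesis
    unfolding finitely_based_def
    using add_literals_formulas[OF \<phi> \<Psi>(1)] finite_add_literals[OF \<Psi>(2)]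
    by (intro exI[of _ "add_literals \<phi> \<Psi> k"]) simp
qed

text \<open>If every formula of the finite base failed, each would fail on some finite set. All
  instances over the union of these sets are decided by one event of \<open>G\<close>, and a basic
  set lies inside it, so its formula succeeds on its own finite set. The decided values are those of
  \<open>b\<close>, because \<open>b\<close> satisfies that formula.\<close>

lemma finitely_based_compresses:
  assumes G: "finitely_based L U C G"
    and dec: "\<And>a. a \<in> params \<phi> C \<Longrightarrow> \<exists>e. eventually (\<lambda>x. test U \<phi> a x = e) G"
    and b: "b \<in> carrier U"
    and real: "\<And>\<psi> c. \<psi> \<in> formulas L \<Longrightarrow> c ` (fv \<psi> - {0}) \<subseteq> C \<Longrightarrow> eventually (test U \<psi> c) G \<Longrightarrow>
       test U \<psi> c b"
  shows "\<exists>\<psi>\<in>formulas L. compresses U C b \<phi> \<psi>"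
proof (rule ccontr)
  assume "\<not> ?thesis"
  then have neg: "\<not> compresses U C b \<phi> \<psi>" if "\<psi> \<in> formulas L" for \<psi>
    using that by blast
  obtain \<Psi> where \<Psi>: "\<Psi> \<subseteq> formulas L" "finite \<Psi>"
    and \<Psi>': "\<And>P. eventually P G \<Longrightarrow>
         (\<exists>\<psi>\<in>\<Psi>. \<exists>c. c ` (fv \<psi> - {0}) \<subseteq> C \<and> eventually (test U \<psi> c) G \<and>
            (\<forall>x\<in>carrier U. test U \<psi> c x \<longrightarrow> P x))"
    using G unfolding finitely_based_def by metis
  let ?good = "\<lambda>A0 \<psi> c. c ` (fv \<psi> - {0}) \<subseteq> C \<and> sat U (c(0 := b)) \<psi> \<and>
           (\<forall>x\<in>carrier U. sat U (c(0 := x)) \<psi> \<longrightarrow>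
              (\<forall>a. a ` (fv \<phi> - {0}) \<subseteq> A0 \<longrightarrow> sat U (a(0 := x)) \<phi> = sat U (a(0 := b)) \<phi>))"
  have "\<forall>\<psi>\<in>\<Psi>. \<exists>A0. A0 \<subseteq> C \<and> finite A0 \<and> (\<nexists>c. ?good A0 \<psi> c)"
  proof
    fix \<psi> assume "\<psi> \<in> \<Psi>"
    then have "\<not> compresses U C b \<phi> \<psi>" using neg \<Psi>(1) by blast
    then show "\<exists>A0. A0 \<subseteq> C \<and> finite A0 \<and> (\<nexists>c. ?good A0 \<psi> c)"
      unfolding compresses_def not_all not_imp by (simp only: conj_assoc)
  qed
  from bchoice[OF this]
  obtain A where A: "\<forall>\<psi>\<in>\<Psi>. A \<psi> \<subseteq> C \<and> finite (A \<psi>) \<and> (\<nexists>c. ?good (A \<psi>) \<psi> c)"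
    by (elim exE)
  define A0 where "A0 = (\<Union>\<psi>\<in>\<Psi>. A \<psi>)"
  have A0: "A0 \<subseteq> C" "finite A0"
    using A \<Psi>(2) by (auto simp: A0_def)
  have "\<forall>a\<in>params \<phi> C. \<exists>e. eventually (\<lambda>x. test U \<phi> a x = e) G"
    using dec by (simp only: Ball_def) simp
  from bchoice[OF this]
  obtain e where e: "\<forall>a\<in>params \<phi> C. eventually (\<lambda>x. test U \<phi> a x = e a) G"
    by (elim exE)
  have "params \<phi> A0 \<subseteq> params \<phi> C"
    unfolding params_def using A0(1) by (intro PiE_mono) auto
  then have "eventually (\<lambda>x. \<forall>a\<in>params \<phi> A0. test U \<phi> a x = e a) G"
    using e finite_params[OF A0(2)] by (intro eventually_ball_finite) auto
  from \<Psi>'[OF this] obtain \<psi> c where \<psi>: "\<psi> \<in> \<Psi>" "c ` (fv \<psi> - {0}) \<subseteq> C"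
     "eventually (test U \<psi> c) G"
     "\<forall>x\<in>carrier U. test U \<psi> c x \<longrightarrow> (\<forall>a\<in>params \<phi> A0. test U \<phi> a x = e a)"
    by (elim bexE exE conjE)
  have tb: "test U \<psi> c b"
    using \<psi>(1) \<Psi>(1) by (intro real[OF _ \<psi>(2,3)]) blast
  have "test U \<phi> a x = test U \<phi> a b"
    if "x \<in> carrier U" "test U \<psi> c x" "a ` (fv \<phi> - {0}) \<subseteq> A0" for x a
  proof -
    have "restrict a (fv \<phi> - {0}) \<in> params \<phi> A0"
      using that(3) by (auto simp: params_def)
    then show ?thesis
      using \<psi>(4) that(1,2) b tb test_restrict by metis
  qed
  moreover have "A \<psi> \<subseteq> A0"
    using \<psi>(1) by (auto simp: A0_def)
  ultimately have "sat U (a(0 := x)) \<phi> = sat U (a(0 := b)) \<phi>"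
    if "x \<in> carrier U" "sat U (c(0 := x)) \<psi>" "a ` (fv \<phi> - {0}) \<subseteq> A \<psi>" for x a
    using that unfolding test_def by (meson order.trans)
  then have "?good (A \<psi>) \<psi> c"
    using \<psi>(2) tb unfolding test_def by simp
  then have "\<exists>c. ?good (A \<psi>) \<psi> c"
    by (rule exI[where x = c])
  moreover have "\<nexists>c. ?good (A \<psi>) \<psi> c"
    using A[rule_format, OF \<psi>(1)] by (elim conjE)
  ultimately show False by (rule notE[rotated])
qed

section \<open>Realizing a deciding filter by saturation\<close>

lemma decided_by_filter:
  assumes dec: "\<And>\<phi> a. \<phi> \<in> formulas L \<Longrightarrow> a \<in> params \<phi> C \<Longrightarrow> \<exists>e. eventually (\<lambda>x. test U \<phi> a x = e) G"
    and \<theta>: "\<theta> \<in> formulas_in (lang_const L C) {0}"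
  shows "\<exists>e. eventually (\<lambda>x. sat (struc_const U) (\<lambda>_\<in>{0}. x) \<theta> = e) G"
proof -
  have "wf_fm (lang_const L C) \<theta>" and fv\<theta>: "fv \<theta> \<subseteq> {0}"
    using \<theta> by (auto simp: formulas_in_def formulas_def)
  then obtain \<phi> c where \<phi>: "wf_fm L \<phi>" "\<And>x. 2 * x \<in> fv \<phi> \<Longrightarrow> x \<in> fv \<theta>"
    "\<And>x. Suc (2 * x) \<in> fv \<phi> \<Longrightarrow> c (Suc x) \<in> C"
    "\<And>v. sat (struc_const U) v \<theta> \<longleftrightarrow> sat U (join v c) \<phi>"
    using ex_unconst by (metis (no_types, lifting))
  \<comment> \<open>Even positions stem from free variables of \<open>\<theta>\<close>, so only
    position \<open>0\<close> arises, and it is overwritten by \<open>x\<close>; the default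
    \<open>undefined\<close> never occurs as a parameter.\<close>
  let ?a = "restrict (join (\<lambda>_. undefined) c) (fv \<phi> - {0})"
  have "join (\<lambda>_. undefined) c n \<in> C" if "n \<in> fv \<phi>" "n \<noteq> 0" for n
  proof (cases "even n")
    case True
    then obtain m where "n = 2 * m" by blast
    then show ?thesis using that \<phi>(2)[of m] fv\<theta> by auto
  next
    case False
    then obtain m where "n = Suc (2 * m)" by (metis oddE Suc_eq_plus1)
    then show ?thesis using that \<phi>(3)[of m] by simp
  qed
  then have "?a \<in> params \<phi> C"
    by (auto simp: params_def)
  then obtain e where "eventually (\<lambda>x. test U \<phi> ?a x = e) G"
    using dec[of \<phi> ?a] \<phi>(1) by (auto simp: formulas_def)
  moreover have "test U \<phi> ?a x \<longleftrightarrow> sat (struc_const U) (\<lambda>_\<in>{0}. x) \<theta>" for x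
  proof -
    have 1: "(join (\<lambda>_. undefined) c)(0 := x) = join ((\<lambda>_. undefined)(0 := x)) c"
      using join_upd_even[of "\<lambda>_. undefined" c 0 x] by simp
    have 2: "(\<lambda>_\<in>{0}. x) = (\<lambda>_. undefined)(0 := x)"
      by (auto simp: fun_eq_iff)
    show ?thesis
      using test_restrict[of U \<phi> "join (\<lambda>_. undefined) c" x]
      unfolding \<phi>(4) test_def 1 2 .
  qed
  ultimately show ?thesis by auto
qed

text \<open>The formulas over \<open>C\<close> that hold eventually form a type: finite parts are
  satisfiable because \<open>G\<close> is proper, and completeness comes from \<open>dec\<close>. As
  \<open>C\<close> is small, saturation realizes this type.\<close>

lemma ex_realization_of_filter:
  assumes sat: "saturated L U" and C: "small U C" and G: "G \<noteq> bot" "eventually (\<lambda>b. b \<in> carrier U) G"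
    and dec: "\<And>\<phi> a. \<phi> \<in> formulas L \<Longrightarrow> a \<in> params \<phi> C \<Longrightarrow> \<exists>e. eventually (\<lambda>x. test U \<phi> a x = e) G"
  obtains b where "b \<in> carrier U"
    "\<And>\<psi> c. \<psi> \<in> formulas L \<Longrightarrow> c ` (fv \<psi> - {0}) \<subseteq> C \<Longrightarrow> eventually (test U \<psi> c) G \<Longrightarrow> test U \<psi> c b"
proof -
  let ?s = "\<lambda>\<theta> x. sat (struc_const U) (\<lambda>_\<in>{0}. x) \<theta>"
  let ?p = "{\<theta> \<in> formulas_in (lang_const L C) {0}. eventually (?s \<theta>) G}"
  have "?p \<in> types_over L U {0} C"
    unfolding types_over_def
  proof (intro CollectI conjI allI impI ballI)
    fix q assume q: "finite q \<and> q \<subseteq> ?p"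
    then have "eventually (\<lambda>x. \<forall>\<theta>\<in>q. ?s \<theta> x) G"
      by (intro eventually_ball_finite) auto
    with G(2) have "eventually (\<lambda>x. x \<in> carrier U \<and> (\<forall>\<theta>\<in>q. ?s \<theta> x)) G"
      by (rule eventually_conj)
    then obtain x where "x \<in> carrier U" "\<forall>\<theta>\<in>q. ?s \<theta> x"
      using eventually_happens G(1) by blast
    then show "\<exists>b\<in>{0} \<rightarrow>\<^sub>E carrier U. \<forall>\<theta>\<in>q. sat (struc_const U) b \<theta>"
      by (intro bexI[of _ "\<lambda>_\<in>{0}. x"]) auto
  next
    fix \<theta> assume \<theta>: "\<theta> \<in> formulas_in (lang_const L C) {0}"
    then obtain e where e: "eventually (\<lambda>x. ?s \<theta> x = e) G"
      using decided_by_filter[OF dec] by blast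
    show "\<theta> \<in> ?p \<or> Neg \<theta> \<in> ?p"
      using e \<theta> by (cases e) (auto simp: formulas_in_def formulas_def)
  qed auto
  then obtain b where b: "b \<in> {0} \<rightarrow>\<^sub>E carrier U" "\<forall>\<theta>\<in>?p. sat (struc_const U) b \<theta>"
    using sat C unfolding saturated_def by blast
  have "test U \<psi> c (b 0)"
    if \<psi>: "\<psi> \<in> formulas L" "c ` (fv \<psi> - {0}) \<subseteq> C" "eventually (test U \<psi> c) G" for \<psi> c
  proof -
    let ?\<theta> = "inst (fv \<psi> - {0}) c \<psi>"
    have *: "sat (struc_const U) v ?\<theta> \<longleftrightarrow> test U \<psi> c (v 0)" for v
      unfolding sat_inst test_def by (intro sat_cong) (auto simp: override_on_def)
    have "wf_fm (lang_const L C) ?\<theta>"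
      using \<psi> by (intro wf_inst) (auto simp: formulas_def)
    moreover have "eventually (?s ?\<theta>) G"
      using \<psi>(3) by (simp add: *)
    ultimately have "?\<theta> \<in> ?p"
      by (auto simp: formulas_in_def formulas_def)
    then show ?thesis
      using b(2) * by blast
  qed
  moreover have "b 0 \<in> carrier U" using b(1) by auto
  ultimately show ?thesis using that by blast
qed

text \<open>The chain of filters starts at the solution set of \<open>\<theta>\<close> in the
  carrier, so an element realizing its limit solves \<open>\<theta>\<close>.\<close>

lemma ex_compressible_realization:
  assumes cnt: "countable (formulas L)" and NIP: "NIP L U" and sat: "saturated L U"
    and C: "small U C" and \<theta>: "\<theta> \<in> formulas L" "d ` (fv \<theta> - {0}) \<subseteq> C"
    and a: "a \<in> carrier U" "sat U (d(0 := a)) \<theta>"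
  obtains b where "b \<in> carrier U" "sat U (d(0 := b)) \<theta>" "compressible_elem L U C b"
proof -
  have CU: "C \<subseteq> carrier U" using C by (simp add: small_def)
  let ?\<phi> = "from_nat_into (formulas L)"
  have ne: "formulas L \<noteq> {}" using \<theta>(1) by blast
  have \<phi>: "?\<phi> n \<in> formulas L" for n using ne by (rule from_nat_into)
  let ?G0 = "principal {x \<in> carrier U. test U \<theta> d x}"
  let ?P = "\<lambda>n :: nat. \<lambda>G. G \<noteq> bot \<and> finitely_based L U C G \<and> G \<le> ?G0"
  let ?Q = "\<lambda>n G G'. G' \<le> G \<and>
     (\<forall>a\<in>params (?\<phi> n) C. \<exists>e. eventually (\<lambda>x. test U (?\<phi> n) a x = e) G')"
  \<comment> \<open>Stage \<open>n + 1\<close> decides the \<open>n\<close>-th formula. Each stage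
    keeps a finite base, though the base may grow from stage to stage.\<close>
  have "\<exists>G. \<forall>n. ?P n (G n) \<and> ?Q n (G n) (G (Suc n))"
  proof (rule dependent_nat_choice)
    have "?G0 \<noteq> bot" using a by (auto simp: principal_eq_bot_iff test_def)
    then show "\<exists>G. ?P 0 G"
      using finitely_based_principal[OF \<theta>] by blast
  next
    fix G n assume G: "?P n G"
    obtain m where m: "\<And>G C. C \<subseteq> carrier U \<Longrightarrow> eventually (\<lambda>b. b \<in> carrier U) G \<Longrightarrow>
      shatters_below (test U (?\<phi> n)) (params (?\<phi> n) C) G m"
      using NIP_shatters_below[OF NIP \<phi>[of n]] by blast
    have "eventually (\<lambda>b. b \<in> carrier U) G"
      using G by (auto simp: le_principal elim: eventually_mono)
    then have sb: "shatters_below (test U (?\<phi> n)) (params (?\<phi> n) C) G m"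
      using m CU by blast
    obtain G' k where G': "G' \<noteq> bot" "based (test U (?\<phi> n)) (params (?\<phi> n) C) k G' G"
      "\<And>i. i \<in> params (?\<phi> n) C \<Longrightarrow> \<exists>e. eventually (\<lambda>x. test U (?\<phi> n) i x = e) G'"
      using ex_deciding_filter[OF _ sb] G by blast
    moreover have "finitely_based L U C G'"
      using G finitely_based_step[OF _ G'(2) \<phi>] by blast
    moreover have "G' \<le> G" using G'(2) by (simp add: based_def)
    ultimately show "\<exists>G'. ?P (Suc n) G' \<and> ?Q n G G'"
      using G by (intro exI[of _ G']) auto
  qed
  then obtain G where G: "\<And>n. ?P n (G n)" "\<And>n. ?Q n (G n) (G (Suc n))" by blast
  have anti: "G n \<le> G m" if "m \<le> n" for m n
    using that by (rule lift_Suc_antimono_le[rotated]) (use G(2) in blast)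
  \<comment> \<open>In a decreasing sequence an event of the infimum is an event of some stage, so
    \<open>H\<close> stays proper.\<close>
  define H where "H = (INF n. G n)"
  have H: "H \<le> G n" for n
    unfolding H_def by (rule INF_lower) simp
  have evH: "eventually P H \<longleftrightarrow> (\<exists>n. eventually P (G n))" for P
  proof -
    have "\<exists>x\<in>UNIV. G x \<le> inf (G m) (G n)" for m n
      using anti[of m "max m n"] anti[of n "max m n"] by (intro bexI[of _ "max m n"]) auto
    then show ?thesis
      unfolding H_def by (subst eventually_INF_base) auto
  qed
  have Hbot: "H \<noteq> bot"
    using evH[of "\<lambda>_. False"] G(1) by (auto simp: trivial_limit_def)
  have ev0: "eventually (\<lambda>x. x \<in> carrier U \<and> test U \<theta> d x) H"
    using H[of 0] G(1)[of 0] by (auto simp: le_principal le_filter_def eventually_principal)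
  have dec: "\<exists>e. eventually (\<lambda>x. test U \<phi> a x = e) (G (Suc (to_nat_on (formulas L) \<phi>)))"
    if "\<phi> \<in> formulas L" "a \<in> params \<phi> C" for \<phi> a
    using G(2)[of "to_nat_on (formulas L) \<phi>"] that cnt by simp
  have decH: "\<exists>e. eventually (\<lambda>x. test U \<phi> a x = e) H" if "\<phi> \<in> formulas L" "a \<in> params \<phi> C" for \<phi> a
    using dec[OF that] evH by blast
  have "eventually (\<lambda>b. b \<in> carrier U) H"
    using ev0 by eventually_elim simp
  from ex_realization_of_filter[OF sat C Hbot this decH]
  obtain b where b: "b \<in> carrier U"
    "\<And>\<psi> c. \<psi> \<in> formulas L \<Longrightarrow> c ` (fv \<psi> - {0}) \<subseteq> C \<Longrightarrow> eventually (test U \<psi> c) H \<Longrightarrow> test U \<psi> c b"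
    by blast
  have "compressible_elem L U C b"
    unfolding compressible_elem_def
  proof
    fix \<phi> assume \<phi>: "\<phi> \<in> formulas L"
    \<comment> \<open>Compression of \<open>\<phi>\<close> is read off at the stage that decides it,
      where a finite base is available; \<open>H\<close> serves to make the type complete.\<close>
    let ?n = "Suc (to_nat_on (formulas L) \<phi>)"
    show "\<exists>\<psi>\<in>formulas L. compresses U C b \<phi> \<psi>"
    proof (rule finitely_based_compresses[OF _ dec[OF \<phi>] b(1)])
      show "finitely_based L U C (G ?n)" using G(1) by blast
      show "test U \<psi> c b" if "\<psi> \<in> formulas L" "c ` (fv \<psi> - {0}) \<subseteq> C" "eventually (test U \<psi> c) (G ?n)" for \<psi> c
        using b(2) that evH by blast
    qed
  qed
  moreover have "sat U (d(0 := b)) \<theta>"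
  proof -
    have "eventually (test U \<theta> d) H" using ev0 by eventually_elim simp
    then show ?thesis using b(2)[OF \<theta>] by (simp add: test_def)
  qed
  ultimately show ?thesis using that b(1) by blast
qed

section \<open>Compressible elements and compressible constructibility\<close>

abbreviation compressible_tp :: "('f, 'r) lang \<Rightarrow> ('f, 'r, 'a) struc \<Rightarrow> 'a set \<Rightarrow> 'a \<Rightarrow> bool" where
  "compressible_tp L U C b \<equiv> compressible L U {0} C (tp L U {0} (\<lambda>_\<in>{0}. b) C)"

lemma carrier_struc_const [simp]: "carrier (struc_const U) = carrier U"
  by (simp add: struc_const_def)

lemma tp_in_types_over:
  assumes "b \<in> carrier U"
  shows "tp L U {0} (\<lambda>_\<in>{0}. b) C \<in> types_over L U {0} C"
  unfolding types_over_def
proof (intro CollectI conjI allI impI ballI)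
  fix q assume "finite q \<and> q \<subseteq> tp L U {0} (\<lambda>_\<in>{0}. b) C"
  then show "\<exists>b\<in>{0} \<rightarrow>\<^sub>E carrier U. \<forall>\<theta>\<in>q. sat (struc_const U) b \<theta>"
    using assms by (intro bexI[of _ "\<lambda>_\<in>{0}. b"]) (auto simp: tp_def)
next
  fix \<theta> assume "\<theta> \<in> formulas_in (lang_const L C) {0}"
  then show "\<theta> \<in> tp L U {0} (\<lambda>_\<in>{0}. b) C \<or> Neg \<theta> \<in> tp L U {0} (\<lambda>_\<in>{0}. b) C"
    by (auto simp: tp_def formulas_in_def formulas_def)
qed (auto simp: tp_def)

lemma inst_in_formulas_in:
  assumes "\<phi> \<in> formulas_in L ({0} \<union> Y)" and "a \<in> Y \<rightarrow>\<^sub>E C"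
  shows "inst Y a \<phi> \<in> formulas_in (lang_const L C) {0}"
proof -
  have "a ` (Y \<inter> fv \<phi>) \<subseteq> C" using assms(2) by auto
  then show ?thesis
    using assms(1) wf_inst[of L \<phi> a Y C] by (auto simp: formulas_in_def formulas_def)
qed

text \<open>A formula isolating \<open>b\<close> implies everything in its type, so it compresses
  every \<open>\<phi>\<close>, with the same parameters for all \<open>A0\<close>.\<close>

lemma compressible_tp_isolated:
  assumes b: "b \<in> carrier U" and Z: "finite Z" "0 \<notin> Z" and \<chi>: "\<chi> \<in> formulas_in L ({0} \<union> Z)"
    and c: "c \<in> Z \<rightarrow>\<^sub>E C"
    and iso: "\<And>x. x \<in> carrier U \<Longrightarrow> sat U (override_on (\<lambda>_\<in>{0}. x) c Z) \<chi> \<longleftrightarrow> x = b"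
  shows "compressible_tp L U C b"
  unfolding compressible_def
proof (intro conjI allI impI)
  let ?p = "tp L U {0} (\<lambda>_\<in>{0}. b) C"
  show "?p \<in> types_over L U {0} C"
    using b by (rule tp_in_types_over)
  fix Y \<phi> assume "finite Y \<and> {0} \<inter> Y = {} \<and> \<phi> \<in> formulas_in L ({0} \<union> Y)"
  have inp: "inst Z c \<chi> \<in> ?p"
    using inst_in_formulas_in[OF \<chi> c] iso[OF b] by (simp add: tp_def sat_inst)
  have imp: "implies_in U {0} (inst Z c \<chi>) \<Gamma>" if \<Gamma>: "\<Gamma> \<subseteq> ?p" for \<Gamma>
    unfolding implies_in_def
  proof (intro ballI impI)
    fix v \<gamma> assume v: "v \<in> {0} \<rightarrow>\<^sub>E carrier U" "sat (struc_const U) v (inst Z c \<chi>)" and \<gamma>: "\<gamma> \<in> \<Gamma>"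
    have veq: "v = (\<lambda>_\<in>{0}. v 0)"
      using v(1) by (auto simp: fun_eq_iff PiE_def extensional_def)
    have "sat U (override_on (\<lambda>_\<in>{0}. v 0) c Z) \<chi>"
      using v(2) veq unfolding sat_inst by metis
    then have "v 0 = b"
      using iso[of "v 0"] v(1) by auto
    then show "sat (struc_const U) v \<gamma>"
      using veq \<gamma> \<Gamma> by (auto simp: tp_def)
  qed
  show "\<exists>Z \<psi>. finite Z \<and> {0} \<inter> Z = {} \<and> \<psi> \<in> formulas_in L ({0} \<union> Z) \<and>
         (\<forall>A0. finite A0 \<and> A0 \<subseteq> C \<longrightarrow>
           (\<exists>c \<in> Z \<rightarrow>\<^sub>E C. inst Z c \<psi> \<in> ?p \<and>
              implies_in U {0} (inst Z c \<psi>)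
                ({inst Y a \<phi> | a. a \<in> Y \<rightarrow>\<^sub>E A0 \<and> inst Y a \<phi> \<in> ?p} \<union>
                 {Neg (inst Y a \<phi>) | a. a \<in> Y \<rightarrow>\<^sub>E A0 \<and> Neg (inst Y a \<phi>) \<in> ?p})))"
  proof (intro exI[of _ Z] exI[of _ \<chi>] conjI allI impI)
    fix A0 assume "finite A0 \<and> A0 \<subseteq> C"
    show "\<exists>c \<in> Z \<rightarrow>\<^sub>E C. inst Z c \<chi> \<in> ?p \<and>
              implies_in U {0} (inst Z c \<chi>)
                ({inst Y a \<phi> | a. a \<in> Y \<rightarrow>\<^sub>E A0 \<and> inst Y a \<phi> \<in> ?p} \<union>
                 {Neg (inst Y a \<phi>) | a. a \<in> Y \<rightarrow>\<^sub>E A0 \<and> Neg (inst Y a \<phi>) \<in> ?p})"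
      by (intro bexI[OF _ c] conjI inp imp) auto
  qed (use Z \<chi> in auto)
qed

lemma compressible_tp_member:
  assumes "b \<in> C" and "b \<in> carrier U"
  shows "compressible_tp L U C b"
proof (rule compressible_tp_isolated[OF assms(2), of "{1}" "Eq (Var 0) (Var 1)" _ "\<lambda>_\<in>{1}. b"])
  show "Eq (Var 0) (Var 1) \<in> formulas_in L ({0} \<union> {1})"
    by (auto simp: formulas_in_def formulas_def)
qed (use assms in \<open>auto simp: override_on_def\<close>)

text \<open>The equation with the constant naming \<open>b\<close> isolates \<open>b\<close> without
  parameters. So \<open>C\<close> is arbitrary here, and \<open>F\<close> can be listed before the
  elements whose compressibility presupposes \<open>F \<subseteq> C\<close>.\<close>

lemma compressible_tp_constant:
  assumes "b \<in> F" and "b \<in> carrier U"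
  shows "compressible_tp (lang_const L F) (struc_const U) C b"
proof (rule compressible_tp_isolated[of _ _ "{}" "Eq (Var 0) (Fun (Inr b) [])" _ "\<lambda>_. undefined"])
  show "Eq (Var 0) (Fun (Inr b) []) \<in> formulas_in (lang_const L F) ({0} \<union> {})"
    using assms(1) by (auto simp: formulas_in_def formulas_def lang_const_def)
qed (use assms in \<open>auto simp: override_on_def struc_const_def\<close>)

text \<open>The constants from \<open>F\<close> that occur in a formula of the expanded language become
  additional parameters; this is harmless because \<open>F \<subseteq> C\<close>.\<close>

lemma compressible_tp_of_elem:
  fixes U :: "('f, 'r, 'a) struc"
  assumes FC: "F \<subseteq> C" and b: "b \<in> carrier U" and comp: "compressible_elem L U C b"
  shows "compressible_tp (lang_const L F) (struc_const U) C b"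
  unfolding compressible_def
proof (intro conjI allI impI)
  let ?L = "lang_const L F" and ?U = "struc_const U"
  let ?p = "tp ?L ?U {0} (\<lambda>_\<in>{0}. b) C"
  show "?p \<in> types_over ?L ?U {0} C"
    using b by (intro tp_in_types_over) simp
  fix Y \<phi> assume Y\<phi>: "finite Y \<and> {0} \<inter> Y = {} \<and> \<phi> \<in> formulas_in ?L ({0} \<union> Y)"
  then have "wf_fm ?L \<phi>" and fv\<phi>: "fv \<phi> \<subseteq> {0} \<union> Y" and Y0: "0 \<notin> Y"
    by (auto simp: formulas_in_def formulas_def)
  then obtain \<phi>' c0 where \<phi>': "wf_fm L \<phi>'" "\<And>x. 2 * x \<in> fv \<phi>' \<Longrightarrow> x \<in> fv \<phi>"
    "\<And>x. Suc (2 * x) \<in> fv \<phi>' \<Longrightarrow> c0 (Suc x) \<in> F"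
    "\<And>v. sat (struc_const U) v \<phi> \<longleftrightarrow> sat U (join v c0) \<phi>'"
    using ex_unconst by (metis (no_types, lifting))
  obtain \<psi>' where \<psi>': "\<psi>' \<in> formulas L" "compresses U C b \<phi>' \<psi>'"
    using comp \<phi>'(1) unfolding compressible_elem_def formulas_def by blast
  define Z where "Z = fv \<psi>' - {0}"
  \<comment> \<open>Substituting for no variable merely moves \<open>\<psi>'\<close> into the
    expanded language.\<close>
  define \<psi> where "\<psi> = inst {} (undefined :: nat \<Rightarrow> 'a) \<psi>'"
  have \<psi>: "\<psi> \<in> formulas_in ?L ({0} \<union> Z)"
    using \<psi>'(1) wf_inst[of L \<psi>' undefined "{}" F]
    by (auto simp: \<psi>_def Z_def formulas_in_def formulas_def)
  \<comment> \<open>Even positions carry the tuple for \<open>Y\<close>, odd positions the values of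
    the constants eliminated from \<open>\<phi>\<close>.\<close>
  define a' where "a' = (\<lambda>a. join (override_on (\<lambda>_. undefined) a Y) c0)"
  have sat\<phi>: "sat (struc_const ?U) (\<lambda>_\<in>{0}. x) (inst Y a \<phi>) \<longleftrightarrow> sat U ((a' a)(0 := x)) \<phi>'" for x a
  proof -
    have "(a' a)(0 := x) = join ((override_on (\<lambda>_. undefined) a Y)(0 := x)) c0"
      unfolding a'_def using join_upd_even[of _ c0 0 x] by simp
    also have "(override_on (\<lambda>_. undefined) a Y)(0 := x) = override_on (\<lambda>_\<in>{0}. x) a Y"
      using Y0 by (auto simp: override_on_def fun_eq_iff)
    finally show ?thesis by (simp only: sat_inst \<phi>'(4))
  qed
  show "\<exists>Z \<psi>. finite Z \<and> {0} \<inter> Z = {} \<and> \<psi> \<in> formulas_in ?L ({0} \<union> Z) \<and>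
         (\<forall>A0. finite A0 \<and> A0 \<subseteq> C \<longrightarrow>
           (\<exists>c \<in> Z \<rightarrow>\<^sub>E C. inst Z c \<psi> \<in> ?p \<and>
              implies_in ?U {0} (inst Z c \<psi>)
                ({inst Y a \<phi> | a. a \<in> Y \<rightarrow>\<^sub>E A0 \<and> inst Y a \<phi> \<in> ?p} \<union>
                 {Neg (inst Y a \<phi>) | a. a \<in> Y \<rightarrow>\<^sub>E A0 \<and> Neg (inst Y a \<phi>) \<in> ?p})))"
  proof (intro exI[of _ Z] exI[of _ \<psi>] conjI allI impI)
    fix A0 assume A0: "finite A0 \<and> A0 \<subseteq> C"
    \<comment> \<open>The finite set is enlarged by the constants of \<open>\<phi>\<close>, which
      lie in \<open>F \<subseteq> C\<close>; compressing \<open>\<phi>'\<close> over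
      \<open>A1\<close> then decides all instances of \<open>\<phi>\<close> over
      \<open>A0\<close>.\<close>
    define A1 where "A1 = A0 \<union> c0 ` {Suc x | x. Suc (2 * x) \<in> fv \<phi>'}"
    have "finite {x. Suc (2 * x) \<in> fv \<phi>'}"
      using finite_vimageI[OF finite_fv, of "\<lambda>x. Suc (2 * x)" \<phi>'] by (simp add: inj_def vimage_def)
    then have "finite {Suc x | x. Suc (2 * x) \<in> fv \<phi>'}"
      by (simp add: setcompr_eq_image)
    then have "finite A1" "A1 \<subseteq> C"
      using A0 FC \<phi>'(3) by (auto simp: A1_def)
    then obtain c where c: "c ` (fv \<psi>' - {0}) \<subseteq> C" "sat U (c(0 := b)) \<psi>'"
      "\<And>x a. x \<in> carrier U \<Longrightarrow> sat U (c(0 := x)) \<psi>' \<Longrightarrow> a ` (fv \<phi>' - {0}) \<subseteq> A1 \<Longrightarrow>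
         sat U (a(0 := x)) \<phi>' = sat U (a(0 := b)) \<phi>'"
      using \<psi>'(2) unfolding compresses_def by meson
    define cZ where "cZ = restrict c Z"
    have cZ: "cZ \<in> Z \<rightarrow>\<^sub>E C"
      using c(1) by (auto simp: cZ_def Z_def)
    have sat\<psi>: "sat (struc_const ?U) (\<lambda>_\<in>{0}. x) (inst Z cZ \<psi>) \<longleftrightarrow> sat U (c(0 := x)) \<psi>'" for x
      unfolding \<psi>_def sat_inst by (intro sat_cong) (auto simp: override_on_def cZ_def Z_def)
    have inp: "inst Z cZ \<psi> \<in> ?p"
      using inst_in_formulas_in[OF \<psi> cZ] c(2) by (simp add: tp_def sat\<psi>)
    have params: "a' a ` (fv \<phi>' - {0}) \<subseteq> A1" if a: "a \<in> Y \<rightarrow>\<^sub>E A0" for a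
    proof
      fix y assume "y \<in> a' a ` (fv \<phi>' - {0})"
      then obtain n where n: "n \<in> fv \<phi>'" "n \<noteq> 0" "y = a' a n" by auto
      show "y \<in> A1"
      proof (cases "even n")
        case True
        then obtain m where m: "n = 2 * m" by blast
        then have "m \<in> Y" using n \<phi>'(2) fv\<phi> by auto
        then have "y = a m" using n m by (simp add: a'_def)
        then show ?thesis using a \<open>m \<in> Y\<close> by (auto simp: A1_def)
      next
        case False
        then obtain m where m: "n = Suc (2 * m)" by (metis oddE Suc_eq_plus1)
        then have "y = c0 (Suc m)" using n by (simp add: a'_def)
        then show ?thesis using n m by (auto simp: A1_def)
      qed
    qed
    have "sat (struc_const ?U) v \<gamma>"
      if v: "v \<in> {0} \<rightarrow>\<^sub>E carrier U" "sat (struc_const ?U) v (inst Z cZ \<psi>)"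
        and \<gamma>: "\<gamma> = inst Y a \<phi> \<or> \<gamma> = Neg (inst Y a \<phi>)" "a \<in> Y \<rightarrow>\<^sub>E A0" "\<gamma> \<in> ?p" for v \<gamma> a
    proof -
      have veq: "v = (\<lambda>_\<in>{0}. v 0)"
        using v(1) by (auto simp: fun_eq_iff PiE_def extensional_def)
      have v0: "v 0 \<in> carrier U" using v(1) by auto
      have "sat U (c(0 := v 0)) \<psi>'"
        using v(2) sat\<psi>[of "v 0"] veq by simp
      then have "sat U ((a' a)(0 := v 0)) \<phi>' = sat U ((a' a)(0 := b)) \<phi>'"
        using c(3) v0 params \<gamma>(2) by blast
      then have "sat (struc_const ?U) v (inst Y a \<phi>) = sat (struc_const ?U) (\<lambda>_\<in>{0}. b) (inst Y a \<phi>)"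
        using sat\<phi>[of "v 0" a] sat\<phi>[of b a] veq by simp
      then show ?thesis
        using \<gamma>(1,3) by (auto simp: tp_def)
    qed
    then have "implies_in ?U {0} (inst Z cZ \<psi>)
                ({inst Y a \<phi> | a. a \<in> Y \<rightarrow>\<^sub>E A0 \<and> inst Y a \<phi> \<in> ?p} \<union>
                 {Neg (inst Y a \<phi>) | a. a \<in> Y \<rightarrow>\<^sub>E A0 \<and> Neg (inst Y a \<phi>) \<in> ?p})"
      unfolding implies_in_def carrier_struc_const by blast
    then show "\<exists>c \<in> Z \<rightarrow>\<^sub>E C. inst Z c \<psi> \<in> ?p \<and>
              implies_in ?U {0} (inst Z c \<psi>)
                ({inst Y a \<phi> | a. a \<in> Y \<rightarrow>\<^sub>E A0 \<and> inst Y a \<phi> \<in> ?p} \<union>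
                 {Neg (inst Y a \<phi>) | a. a \<in> Y \<rightarrow>\<^sub>E A0 \<and> Neg (inst Y a \<phi>) \<in> ?p})"
      using cZ inp by blast
  qed (use \<psi> in \<open>auto simp: Z_def\<close>)
qed

text \<open>The enumeration may be taken without repetitions, indexed by the constructed set itself.\<close>

definition constructible :: "('f, 'r) lang \<Rightarrow> ('f, 'r, 'a) struc \<Rightarrow> 'a set \<Rightarrow> 'a set \<Rightarrow> bool" where
  "constructible L U A B \<longleftrightarrow>
     (\<exists>s. wf s \<and> total_on B s \<and> (\<forall>b\<in>B. compressible_tp L U (A \<union> {x \<in> B. (x, b) \<in> s}) b))"

section \<open>Well-ordered enumerations: removing repetitions and concatenating\<close>

text \<open>Otherwise \<open>x\<close> and \<open>z\<close> coincide or totality gives the reversed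
  pair, and either way a cycle contradicts well-foundedness.\<close>

lemma wf_total_on_trans:
  assumes "wf s" "total_on J s" "x \<in> J" "z \<in> J" "(x, y) \<in> s" "(y, z) \<in> s"
  shows "(x, z) \<in> s"
proof (rule ccontr)
  assume "(x, z) \<notin> s"
  then have "(z, x) \<in> s\<^sup>*"
    using assms(2-4) by (cases "x = z") (auto simp: total_on_def)
  then have "(x, x) \<in> s\<^sup>+"
    using assms(5,6) by (meson rtrancl_into_trancl2 rtrancl_trans r_into_rtrancl)
  then show False
    using assms(1) by (meson acyclic_def wf_acyclic)
qed

text \<open>Each value is kept at its first index \<open>idx\<close>. A value occurring before that
  index also has its own first index before it, so dropping repetitions leaves the sets of
  predecessors unchanged.\<close>

lemma constructible_imageI:
  assumes s: "wf s" "total_on J s"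
    and e: "\<And>i. i \<in> J \<Longrightarrow> compressible_tp L U (A \<union> e ` {j \<in> J. (j, i) \<in> s}) (e i)"
  shows "constructible L U A (e ` J)"
proof -
  have "\<forall>b\<in>e ` J. \<exists>i. i \<in> J \<and> e i = b \<and> (\<forall>j\<in>J. (j, i) \<in> s \<longrightarrow> e j \<noteq> b)"
  proof
    fix b assume "b \<in> e ` J"
    then obtain i0 where "i0 \<in> {i \<in> J. e i = b}" by auto
    from wfE_min[OF s(1) this] show "\<exists>i. i \<in> J \<and> e i = b \<and> (\<forall>j\<in>J. (j, i) \<in> s \<longrightarrow> e j \<noteq> b)"
      by (metis (mono_tags, lifting) mem_Collect_eq)
  qed
  from bchoice[OF this] obtain idx where
    "\<forall>b\<in>e ` J. idx b \<in> J \<and> e (idx b) = b \<and> (\<forall>j\<in>J. (j, idx b) \<in> s \<longrightarrow> e j \<noteq> b)"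
    by (elim exE)
  then have idx: "idx (e j) \<in> J" "e (idx (e j)) = e j"
    and least: "\<And>k. k \<in> J \<Longrightarrow> (k, idx (e j)) \<in> s \<Longrightarrow> e k \<noteq> e j" if "j \<in> J" for j
    using that by auto
  have "total_on (e ` J) (inv_image s idx)"
    using s(2) idx unfolding total_on_def in_inv_image by (metis imageE)
  moreover have "compressible_tp L U (A \<union> {x \<in> e ` J. (x, b) \<in> inv_image s idx}) b" if "b \<in> e ` J" for b
  proof -
    have b: "idx b \<in> J" "e (idx b) = b" using idx that by auto
    have "{x \<in> e ` J. (x, b) \<in> inv_image s idx} = e ` {j \<in> J. (j, idx b) \<in> s}"
    proof (intro equalityI subsetI)
      fix x assume "x \<in> {x \<in> e ` J. (x, b) \<in> inv_image s idx}"
      then have "idx x \<in> {j \<in> J. (j, idx b) \<in> s}" "x = e (idx x)" using idx by auto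
      then show "x \<in> e ` {j \<in> J. (j, idx b) \<in> s}" by (rule rev_image_eqI)
    next
      fix x assume "x \<in> e ` {j \<in> J. (j, idx b) \<in> s}"
      then obtain j where j: "j \<in> J" "(j, idx b) \<in> s" "x = e j" by auto
      have "idx x = j \<or> (idx x, j) \<in> s"
        using least[OF j(1) j(1)] idx(1)[OF j(1)] j(1,3) s(2) unfolding total_on_def by blast
      then have "(idx x, idx b) \<in> s"
        using j wf_total_on_trans[OF s] idx(1)[OF j(1)] b(1) by blast
      then show "x \<in> {x \<in> e ` J. (x, b) \<in> inv_image s idx}" using j by simp
    qed
    then show ?thesis using e[OF b(1)] b(2) by simp
  qed
  ultimately show ?thesis
    unfolding constructible_def using wf_inv_image[OF s(1)] by blast
qed

lemma constructible_iff_compressibly_constructible: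
  fixes U :: "('f, 'r, 'a) struc"
  shows "constructible L U A B \<longleftrightarrow> compressibly_constructible L U A B"
proof
  assume "constructible L U A B"
  then obtain s where s: "wf s" "total_on B s" "\<And>b. b \<in> B \<Longrightarrow> compressible_tp L U (A \<union> {x \<in> B. (x, b) \<in> s}) b"
    unfolding constructible_def by blast
  define r where "r = {(x, y). x \<in> B \<and> y \<in> B \<and> (x = y \<or> (x, y) \<in> s)}"
  have F: "Field r = B" by (auto simp: r_def Field_def)
  have "Well_order r"
    unfolding F well_order_on_def linear_order_on_def partial_order_on_def preorder_on_def
  proof (intro conjI)
    show "refl_on B r" by (auto simp: r_def refl_on_def)
    show "r \<subseteq> B \<times> B" by (auto simp: r_def)
    show "trans r"
      using wf_total_on_trans[OF s(1,2)] unfolding r_def trans_def by blast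
    show "antisym r"
      using wf_not_sym[OF s(1)] unfolding r_def antisym_def by blast
    show "total_on B r"
      using s(2) unfolding total_on_def r_def by blast
    show "wf (r - Id)"
      by (rule wf_subset[OF s(1)]) (auto simp: r_def)
  qed
  moreover have "{j. (j, i) \<in> r \<and> j \<noteq> i} = {x \<in> B. (x, i) \<in> s}" if "i \<in> B" for i
    using that wf_not_refl[OF s(1)] by (auto simp: r_def)
  ultimately show "compressibly_constructible L U A B"
    unfolding compressibly_constructible_def Let_def
    using s(3) F by (intro exI[of _ r] exI[of _ "\<lambda>x. x"]) simp
next
  assume "compressibly_constructible L U A B"
  then obtain r :: "'a rel" and b where r: "Well_order r" "b ` Field r = B"
    "\<And>i. i \<in> Field r \<Longrightarrow> compressible_tp L U (A \<union> b ` {j. (j, i) \<in> r \<and> j \<noteq> i}) (b i)"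
    unfolding compressibly_constructible_def Let_def by blast
  have "{j \<in> Field r. (j, i) \<in> r - Id} = {j. (j, i) \<in> r \<and> j \<noteq> i}" for i
    by (auto simp: Field_def)
  then have "constructible L U A (b ` Field r)"
    using r(1,3)
    by (intro constructible_imageI[of "r - Id"])
       (auto simp: well_order_on_def linear_order_on_def total_on_def)
  then show "constructible L U A B" using r(2) by simp
qed

lemma ex_wf_total: "\<exists>s :: 'b rel. wf s \<and> total_on UNIV s"
proof -
  obtain r :: "'b rel" where "well_order_on UNIV r"
    using well_order_on by blast
  then have "wf (r - Id) \<and> total_on UNIV (r - Id)"
    by (auto simp: well_order_on_def linear_order_on_def total_on_def)
  then show ?thesis by blast
qed

text \<open>Compressibility over every larger base makes the order of listing immaterial. This
  covers the elements of \<open>A\<close> itself and the named elements of \<open>F\<close>.\<close>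

lemma constructible_any_order:
  fixes U :: "('f, 'r, 'a) struc"
  assumes "\<And>b C. b \<in> B \<Longrightarrow> A \<subseteq> C \<Longrightarrow> compressible_tp L U C b"
  shows "constructible L U A B"
proof -
  obtain s :: "'a rel" where "wf s" "total_on UNIV s"
    using ex_wf_total by blast
  then show ?thesis
    unfolding constructible_def using assms by (intro exI[of _ s]) (auto simp: total_on_def)
qed

lemma constructible_Un:
  fixes U :: "('f, 'r, 'a) struc"
  assumes "constructible L U A B" and "constructible L U (A \<union> B) B'"
  shows "constructible L U A (B \<union> B')"
proof -
  obtain s where s: "wf s" "total_on B s" "\<And>b. b \<in> B \<Longrightarrow> compressible_tp L U (A \<union> {x \<in> B. (x, b) \<in> s}) b"
    using assms(1) unfolding constructible_def by blast
  obtain s' where s': "wf s'" "total_on B' s'"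
    "\<And>b. b \<in> B' \<Longrightarrow> compressible_tp L U (A \<union> B \<union> {x \<in> B'. (x, b) \<in> s'}) b"
    using assms(2) unfolding constructible_def by blast
  \<comment> \<open>\<open>B\<close> comes first. An element of both sets keeps its place in
    \<open>B\<close>, so every element listed later has all of \<open>B\<close> below it.\<close>
  define t where "t = {(x, y). if y \<in> B then x \<in> B \<and> (x, y) \<in> s else x \<in> B \<or> (x, y) \<in> s'}"
  have "wf t"
  proof (rule wfI_min)
    fix x Q assume "x \<in> (Q :: 'a set)"
    show "\<exists>z\<in>Q. \<forall>y. (y, z) \<in> t \<longrightarrow> y \<notin> Q"
    proof (cases "Q \<inter> B = {}")
      case True
      obtain z where "z \<in> Q" "\<And>y. (y, z) \<in> s' \<Longrightarrow> y \<notin> Q"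
        using wfE_min[OF s'(1) \<open>x \<in> Q\<close>] by blast
      with True show ?thesis by (intro bexI[of _ z]) (auto simp: t_def)
    next
      case False
      then obtain x' where "x' \<in> Q \<inter> B" by blast
      from wfE_min[OF s(1) this] obtain z where "z \<in> Q \<inter> B" "\<And>y. (y, z) \<in> s \<Longrightarrow> y \<notin> Q \<inter> B"
        by blast
      then show ?thesis by (intro bexI[of _ z]) (auto simp: t_def)
    qed
  qed
  moreover have "total_on (B \<union> B') t"
    using s(2) s'(2) unfolding total_on_def t_def by auto
  moreover have "compressible_tp L U (A \<union> {x \<in> B \<union> B'. (x, b) \<in> t}) b" if b: "b \<in> B \<union> B'" for b
  proof (cases "b \<in> B")
    case True
    then have "{x \<in> B \<union> B'. (x, b) \<in> t} = {x \<in> B. (x, b) \<in> s}" by (auto simp: t_def)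
    then show ?thesis using s(3)[OF True] by simp
  next
    case False
    then have "A \<union> {x \<in> B \<union> B'. (x, b) \<in> t} = A \<union> B \<union> {x \<in> B'. (x, b) \<in> s'}" by (auto simp: t_def)
    then show ?thesis using s'(3)[of b] b False by simp
  qed
  ultimately show ?thesis unfolding constructible_def by blast
qed

section \<open>Cardinalities\<close>

text \<open>Comparability of cardinals links the two notions; the arithmetic of
  \<open>ordLess\<close> then yields the bounds for infinite sets below.\<close>

lemma lesspoll_iff_ordLess: "A \<prec> B \<longleftrightarrow> (card_of A, card_of B) \<in> ordLess"
proof -
  have "A \<prec> B \<longleftrightarrow> \<not> B \<lesssim> A"
  proof
    show "A \<prec> B \<Longrightarrow> \<not> B \<lesssim> A"
      by (auto simp: lesspoll_def dest: lepoll_antisym)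
    assume n: "\<not> B \<lesssim> A"
    then have "(card_of A, card_of B) \<in> ordLess"
      using card_of_ordLess[of B A] unfolding lepoll_def by blast
    then have "A \<lesssim> B"
      unfolding lepoll_def using card_of_ordLeq[of A B] ordLess_imp_ordLeq by blast
    then show "A \<prec> B"
      using n unfolding lesspoll_def by (meson eqpoll_imp_lepoll eqpoll_sym)
  qed
  then show ?thesis
    using card_of_ordLess[of B A] unfolding lepoll_def by blast
qed

lemma Plus_lesspoll_infinite: "infinite C \<Longrightarrow> A \<prec> C \<Longrightarrow> B \<prec> C \<Longrightarrow> A <+> B \<prec> C"
  unfolding lesspoll_iff_ordLess by (rule card_of_Plus_ordLess_infinite)

lemma Un_lesspoll_infinite: "infinite C \<Longrightarrow> A \<prec> C \<Longrightarrow> B \<prec> C \<Longrightarrow> A \<union> B \<prec> C"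
  unfolding lesspoll_iff_ordLess by (rule card_of_Un_ordLess_infinite)

lemma countable_lesspoll_uncountable: "countable A \<Longrightarrow> uncountable C \<Longrightarrow> A \<prec> C"
  unfolding lesspoll_iff_ordLess
  using card_of_ordLess[of C A] countable_lepoll[of A C] by (auto simp: lepoll_def)

text \<open>A code is a Henkin term: \<open>Node \<phi> cs\<close> names a solution of \<open>\<phi>\<close> whose parameters are
  the elements named by \<open>cs\<close>.\<close>

datatype ('g, 'a) code = Elem 'a | Node 'g "('g, 'a) code list"

definition codes :: "'g set \<Rightarrow> 'a set \<Rightarrow> ('g, 'a) code set" where
  "codes G K = {c. set1_code c \<subseteq> G \<and> set2_code c \<subseteq> K}"

lemma Elem_in_codes [simp]: "Elem b \<in> codes G K \<longleftrightarrow> b \<in> K"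
  by (simp add: codes_def)

lemma Node_in_codes [simp]: "Node g cs \<in> codes G K \<longleftrightarrow> g \<in> G \<and> set cs \<subseteq> codes G K"
  by (auto simp: codes_def)

text \<open>A pairing \<open>p\<close> and two tags embed codes into a set: the tags separate
  \<open>Elem\<close> from \<open>Node\<close> and, in the same way, the empty list from a nonempty
  one. Unique reading gives injectivity.\<close>

primrec encode ::
    "('s \<times> 's \<Rightarrow> 's) \<Rightarrow> 's \<Rightarrow> 's \<Rightarrow> ('g \<Rightarrow> 's) \<Rightarrow> ('a \<Rightarrow> 's) \<Rightarrow> ('g, 'a) code \<Rightarrow> 's" where
  "encode p t0 t1 j i (Elem b) = p (t0, i b)"
| "encode p t0 t1 j i (Node g cs) =
     p (t1, p (j g, foldr (\<lambda>x y. p (t1, p (x, y))) (map (encode p t0 t1 j i) cs) (p (t0, t0))))"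

lemma encode_inj:
  assumes p: "inj_on p (S \<times> S)" "p ` (S \<times> S) \<subseteq> S" and t: "t0 \<in> S" "t1 \<in> S" "t0 \<noteq> t1"
    and j: "inj_on j G" "j ` G \<subseteq> S" and i: "inj_on i K" "i ` K \<subseteq> S"
  shows "inj_on (encode p t0 t1 j i) (codes G K)" and "encode p t0 t1 j i ` codes G K \<subseteq> S"
proof -
  let ?e = "encode p t0 t1 j i"
  let ?f = "\<lambda>xs. foldr (\<lambda>x y. p (t1, p (x, y))) xs (p (t0, t0))"
  have pS: "p (x, y) \<in> S" if "x \<in> S" "y \<in> S" for x y
    using p(2) that by blast
  have pinj: "p (x, y) = p (x', y') \<longleftrightarrow> x = x' \<and> y = y'" if "x \<in> S" "y \<in> S" "x' \<in> S" "y' \<in> S" for x y x' y'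
    using inj_onD[OF p(1), of "(x, y)" "(x', y')"] that by auto
  have tag: "p (t0, x) \<noteq> p (t1, y)" "p (t1, y) \<noteq> p (t0, x)" if "x \<in> S" "y \<in> S" for x y
    using pinj[of t0 x t1 y] t that by auto
  have fS: "?f xs \<in> S" if "set xs \<subseteq> S" for xs
    using that by (induction xs) (auto intro!: pS t)
  have eS: "c \<in> codes G K \<Longrightarrow> ?e c \<in> S" for c
  proof (induction c)
    case (Elem b)
    then show ?case using i(2) t by (auto intro!: pS)
  next
    case (Node g cs)
    then have "?f (map ?e cs) \<in> S" by (intro fS) auto
    then show ?case using Node j(2) t by (auto intro!: pS)
  qed
  then show "?e ` codes G K \<subseteq> S" by blast
  have finj: "xs = ys" if "set xs \<subseteq> S" "set ys \<subseteq> S" "?f xs = ?f ys" for xs ys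
    using that
  proof (induction xs arbitrary: ys)
    case Nil
    show ?case
    proof (cases ys)
      case (Cons y ys')
      then have "p (y, ?f ys') \<in> S" using Nil.prems by (intro pS fS) auto
      then show ?thesis using tag(1)[OF t(1)] Nil.prems Cons by auto
    qed simp
  next
    case (Cons x xs)
    have x: "x \<in> S" "?f xs \<in> S" using Cons.prems fS by auto
    show ?case
    proof (cases ys)
      case Nil
      then show ?thesis using tag(2)[OF t(1) pS[OF x]] Cons.prems by auto
    next
      case (Cons y ys')
      have y: "y \<in> S" "?f ys' \<in> S" using Cons.prems Cons fS by auto
      have "p (t1, p (x, ?f xs)) = p (t1, p (y, ?f ys'))"
        using Cons.prems(3) Cons by simp
      then have "x = y" "?f xs = ?f ys'"
        using pinj[OF t(2) pS[OF x] t(2) pS[OF y]] pinj[OF x y] by auto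
      then show ?thesis using Cons.IH[of ys'] Cons.prems Cons by simp
    qed
  qed
  have node: "j g \<in> S" "?f (map ?e cs) \<in> S" if "Node g cs \<in> codes G K" for g cs
  proof -
    show "j g \<in> S" using that j(2) by auto
    show "?f (map ?e cs) \<in> S" using that eS by (intro fS) auto
  qed
  have "c \<in> codes G K \<Longrightarrow> c' \<in> codes G K \<Longrightarrow> ?e c = ?e c' \<Longrightarrow> c = c'" for c c'
  proof (induction c arbitrary: c')
    case (Elem b)
    have b: "b \<in> K" "i b \<in> S" using Elem.prems i by auto
    show ?case
    proof (cases c')
      case (Elem b')
      then have b': "b' \<in> K" "i b' \<in> S" using Elem.prems i by auto
      then have "i b = i b'"
        using pinj[OF t(1) b(2) t(1) b'(2)] Elem.prems Elem by simp
      then show ?thesis using Elem inj_onD[OF i(1)] b b' by simp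
    next
      case (Node g cs)
      then show ?thesis
        using tag(1)[OF b(2) pS[OF node, of g cs g cs]] Elem.prems by simp
    qed
  next
    case (Node g cs)
    note n = node[OF Node.prems(1)]
    show ?case
    proof (cases c')
      case (Elem b')
      then have "i b' \<in> S" using Node.prems i by auto
      then show ?thesis using tag(2)[OF _ pS[OF n], of "i b'"] Node.prems Elem by simp
    next
      case c': (Node g' cs')
      have n': "j g' \<in> S" "?f (map ?e cs') \<in> S"
        using node[of g' cs'] Node.prems(2) c' by auto
      have "p (t1, p (j g, ?f (map ?e cs))) = p (t1, p (j g', ?f (map ?e cs')))"
        using Node.prems(3) c' by simp
      then have eq: "j g = j g'" "?f (map ?e cs) = ?f (map ?e cs')"
        using pinj[OF t(2) pS[OF n] t(2) pS[OF n']] pinj[OF n n'] by auto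
      have sub: "set cs \<subseteq> codes G K" "set cs' \<subseteq> codes G K" "g \<in> G" "g' \<in> G"
        using c' Node.prems(1,2) by auto
      have "map ?e cs = map ?e cs'"
        by (rule finj[OF _ _ eq(2)]) (use sub eS in auto)
      moreover have "x = y" if "x \<in> set cs" "y \<in> set cs'" "?e x = ?e y" for x y
        using Node.IH[OF that(1) _ _ that(3)] that sub by blast
      ultimately have "cs = cs'"
        by (intro list.inj_map_strong[of cs cs' ?e ?e]) auto
      moreover have "g = g'" using inj_onD[OF j(1) eq(1)] sub by simp
      ultimately show ?thesis using c' by simp
    qed
  qed
  then show "inj_on ?e (codes G K)" by (auto intro: inj_onI)
qed

text \<open>An infinite set absorbs its square, which supplies the pairing for
  \<open>encode\<close>.\<close>

lemma codes_lepoll: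
  assumes "infinite S" and "G \<lesssim> S" and "K \<lesssim> S"
  shows "codes G K \<lesssim> S"
proof -
  have "\<exists>p. inj_on p (S \<times> S) \<and> p ` (S \<times> S) \<subseteq> S"
    unfolding card_of_ordLeq
    using card_of_Times_same_infinite[OF assms(1)] by (rule ordIso_imp_ordLeq)
  then obtain p where p: "inj_on p (S \<times> S)" "p ` (S \<times> S) \<subseteq> S" by blast
  obtain t0 where t0: "t0 \<in> S" using assms(1) by fastforce
  have "infinite (S - {t0})" using assms(1) by simp
  then obtain t1 where t1: "t1 \<in> S" "t0 \<noteq> t1"
    using infinite_imp_nonempty by blast
  obtain j i where "inj_on j G" "j ` G \<subseteq> S" "inj_on i K" "i ` K \<subseteq> S"
    using assms(2,3) unfolding lepoll_def by blast
  from encode_inj[OF p t0 t1 this] show ?thesis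
    unfolding lepoll_def by blast
qed

section \<open>The construction of the model\<close>

text \<open>Well-founded recursion on codes: each code receives a compressible element over
  \<open>D\<close> and all earlier values, chosen to solve the formula of the code if that is
  possible. There are fewer codes than elements of the carrier, so the base stays small.\<close>

lemma ex_code_enumeration:
  fixes U :: "('f, 'r, 'a) struc"
  assumes cnt: "countable (formulas L)" and NIP: "NIP L U" and sat: "saturated L U"
    and inf: "infinite (carrier U)"
    and D: "small U D" and KD: "K \<subseteq> D" and J: "codes (formulas L) K \<prec> carrier U"
  obtains e :: "(('f, 'r) fm, 'a) code \<Rightarrow> 'a" and s where "wf s" "total_on (codes (formulas L) K) s"
    "\<And>x. x \<in> codes (formulas L) K \<Longrightarrow> e x \<in> carrier U \<and>
       compressible_elem L U (D \<union> e ` {y \<in> codes (formulas L) K. (y, x) \<in> s}) (e x)"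
    "\<And>b. b \<in> K \<Longrightarrow> e (Elem b) = b"
    "\<And>\<phi> cs a. Node \<phi> cs \<in> codes (formulas L) K \<Longrightarrow> fv \<phi> \<subseteq> {..<length cs} \<Longrightarrow> a \<in> carrier U \<Longrightarrow>
       sat U ((\<lambda>n. e (cs ! n))(0 := a)) \<phi> \<Longrightarrow> sat U ((\<lambda>n. e (cs ! n))(0 := e (Node \<phi> cs))) \<phi>"
proof -
  let ?J = "codes (formulas L) K"
  obtain r :: "(('f, 'r) fm, 'a) code rel" where r: "wf r" "total_on UNIV r"
    using ex_wf_total by blast
  \<comment> \<open>Size is compared first, so the entries of \<open>cs\<close> precede
    \<open>Node \<phi> cs\<close>; \<open>r\<close> breaks ties.\<close>
  define s where "s = inv_image (less_than <*lex*> r) (\<lambda>x :: (('f, 'r) fm, 'a) code. (size x, x))"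
  have s: "wf s" "total_on ?J s"
    unfolding s_def using r by (auto simp: total_on_def intro!: wf_inv_image wf_lex_prod)
  have sub: "(c, Node \<phi> cs) \<in> s" if "c \<in> set cs" for c \<phi> cs
    using size_list_estimation'[OF that order.refl, of size] by (simp add: s_def)
  define C where "C = (\<lambda>f x. D \<union> f ` {y \<in> ?J. (y, x) \<in> s})"
  \<comment> \<open>\<open>Elem b\<close> asks for a solution of \<open>x = b\<close> with the
    parameter \<open>b\<close> from \<open>D\<close>, which forces its value to be
    \<open>b\<close>.\<close>
  define req where "req = (\<lambda>(f :: (('f, 'r) fm, 'a) code \<Rightarrow> 'a) x. case x of Elem b \<Rightarrow> (Eq (Var 0) (Var 1), \<lambda>_. b)
     | Node \<phi> cs \<Rightarrow> (\<phi>, \<lambda>n. if n < length cs then f (cs ! n) else undefined))"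
  \<comment> \<open>The request is conditional, so an unsolvable one still admits a value: any
    compressible element will do, and a trivial equation provides one.\<close>
  define good where "good = (\<lambda>f x b. b \<in> carrier U \<and> compressible_elem L U (C f x) b \<and>
     (\<forall>\<theta> d a. (\<theta>, d) = req f x \<longrightarrow> \<theta> \<in> formulas L \<longrightarrow> d ` (fv \<theta> - {0}) \<subseteq> C f x \<longrightarrow> a \<in> carrier U \<longrightarrow>
        sat U (d(0 := a)) \<theta> \<longrightarrow> sat U (d(0 := b)) \<theta>))"
  have ex_good: "\<exists>b. good f x b" if small: "small U (C f x)" for f x
  proof -
    obtain \<theta> d where \<theta>d: "(\<theta>, d) = req f x" by (metis surj_pair)
    show ?thesis
    proof (cases "\<theta> \<in> formulas L \<and> d ` (fv \<theta> - {0}) \<subseteq> C f x \<and> (\<exists>a\<in>carrier U. sat U (d(0 := a)) \<theta>)")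
      case True
      then obtain b where "b \<in> carrier U" "sat U (d(0 := b)) \<theta>" "compressible_elem L U (C f x) b"
        using ex_compressible_realization[OF cnt NIP sat small] by blast
      then have "good f x b" unfolding good_def \<theta>d[symmetric] by blast
      then show ?thesis ..
    next
      case False
      obtain a where "a \<in> carrier U" using inf by fastforce
      then obtain b where "b \<in> carrier U" "compressible_elem L U (C f x) b"
        using ex_compressible_realization[OF cnt NIP sat small, of "Eq (Var 0) (Var 0)" undefined a]
        by (auto simp: formulas_def)
      then have "good f x b" unfolding good_def \<theta>d[symmetric] using False by blast
      then show ?thesis ..
    qed
  qed
  define H where "H = (\<lambda>f x. SOME b. good f x b)"
  define e where "e = wfrec s H"
  have e: "e x = H (cut e s x) x" for x
    unfolding e_def by (rule wfrec[OF s(1)])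
  \<comment> \<open>Both the base and the request consult only predecessors of \<open>x\<close>, so
    cutting the function off changes neither.\<close>
  have "cut e s x ` {y \<in> ?J. (y, x) \<in> s} = e ` {y \<in> ?J. (y, x) \<in> s}" for x
    by (intro image_cong refl) (simp add: cut_apply)
  then have C_cut: "C (cut e s x) x = C e x" for x
    by (simp add: C_def)
  have req_cut: "req (cut e s x) x = req e x" for x
    by (cases x) (auto simp: req_def fun_eq_iff cut_apply[OF sub])
  have good_cut: "good (cut e s x) x = good e x" for x
    unfolding good_def C_cut req_cut ..
  have good: "x \<in> ?J \<Longrightarrow> good e x (e x)" for x
  proof (induction x rule: wf_induct_rule[OF s(1)])
    case (1 x)
    let ?E = "e ` {y \<in> ?J. (y, x) \<in> s}"
    have "?E \<subseteq> carrier U"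
      using 1 unfolding good_def by blast
    moreover have "?E \<lesssim> ?J"
      by (rule lepoll_trans[OF image_lepoll subset_imp_lepoll]) blast
    then have "?E \<prec> carrier U" using J by (rule lesspoll_trans1)
    ultimately have "small U (C e x)"
      using D Un_lesspoll_infinite[OF inf, of D ?E] unfolding C_def small_def by blast
    then have "\<exists>b. good (cut e s x) x b"
      unfolding good_cut by (rule ex_good)
    then have "good (cut e s x) x (e x)"
      unfolding e[of x] H_def by (rule someI_ex)
    then show ?case unfolding good_cut .
  qed
  show ?thesis
  proof (rule that[OF s])
    fix x assume "x \<in> ?J"
    then show "e x \<in> carrier U \<and> compressible_elem L U (D \<union> e ` {y \<in> ?J. (y, x) \<in> s}) (e x)"
      using good unfolding good_def C_def by blast
  next
    fix b assume b: "b \<in> K"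
    then have bU: "b \<in> D" "b \<in> carrier U" using KD D by (auto simp: small_def)
    have "good e (Elem b) (e (Elem b))" using good b by simp
    then show "e (Elem b) = b"
      using bU unfolding good_def by (auto simp: req_def C_def formulas_def)
  next
    fix \<phi> cs a
    assume *: "Node \<phi> cs \<in> ?J" "fv \<phi> \<subseteq> {..<length cs}" "a \<in> carrier U"
      "sat U ((\<lambda>n. e (cs ! n))(0 := a)) \<phi>"
    let ?d = "\<lambda>n. if n < length cs then e (cs ! n) else undefined"
    have eq: "sat U (?d(0 := b)) \<phi> \<longleftrightarrow> sat U ((\<lambda>n. e (cs ! n))(0 := b)) \<phi>" for b
      using *(2) by (intro sat_cong) auto
    have "?d ` (fv \<phi> - {0}) \<subseteq> C e (Node \<phi> cs)"
      using *(1,2) sub by (auto simp: C_def subset_iff)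
    then show "sat U ((\<lambda>n. e (cs ! n))(0 := e (Node \<phi> cs))) \<phi>"
      using good[OF *(1)] *(1,3,4) unfolding good_def
      by (metis (no_types, lifting) Node_in_codes code.simps(6) eq req_def)
  qed
qed

section \<open>The Tarski-Vaught test\<close>

definition tarski_vaught :: "('f, 'r) lang \<Rightarrow> ('f, 'r, 'a) struc \<Rightarrow> 'a set \<Rightarrow> bool" where
  "tarski_vaught L U M \<longleftrightarrow>
     (\<forall>\<phi>\<in>formulas L. \<forall>x v. v ` (fv \<phi> - {x}) \<subseteq> M \<longrightarrow> (\<exists>a\<in>carrier U. sat U (v(x := a)) \<phi>) \<longrightarrow>
        (\<exists>a\<in>M. sat U (v(x := a)) \<phi>))"

text \<open>Interchanging \<open>x\<close> and \<open>0\<close> by an involution brings any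
  quantified variable to position \<open>0\<close>.\<close>

lemma tarski_vaughtI:
  assumes "\<And>\<phi> v a. \<phi> \<in> formulas L \<Longrightarrow> v ` (fv \<phi> - {0}) \<subseteq> M \<Longrightarrow> a \<in> carrier U \<Longrightarrow>
    sat U (v(0 := a)) \<phi> \<Longrightarrow> \<exists>a\<in>M. sat U (v(0 := a)) \<phi>"
  shows "tarski_vaught L U M"
  unfolding tarski_vaught_def
proof (intro ballI allI impI)
  fix \<phi> x v assume \<phi>: "\<phi> \<in> formulas L" "v ` (fv \<phi> - {x}) \<subseteq> M" "\<exists>a\<in>carrier U. sat U (v(x := a)) \<phi>"
  define f where "f = (\<lambda>y. if y = 0 then x else if y = x then 0 else y)"
  have ff: "f (f y) = y" for y by (auto simp: f_def)
  have f: "inj f" by (rule inj_on_inverseI[of _ f]) (rule ff)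
  have "((v \<circ> f)(0 := a)) \<circ> f = v(x := a)" for a
    by (auto simp: f_def fun_eq_iff)
  then have eq: "sat U ((v \<circ> f)(0 := a)) (rename f \<phi>) \<longleftrightarrow> sat U (v(x := a)) \<phi>" for a
    by (simp add: sat_rename[OF f])
  have "f y = 0 \<longleftrightarrow> y = x" for y by (auto simp: f_def)
  then have "(v \<circ> f) ` (fv (rename f \<phi>) - {0}) = v ` (fv \<phi> - {x})"
    by (force simp: fv_rename[OF f] ff)
  then have "(v \<circ> f) ` (fv (rename f \<phi>) - {0}) \<subseteq> M"
    using \<phi>(2) by simp
  then show "\<exists>a\<in>M. sat U (v(x := a)) \<phi>"
    using assms[of "rename f \<phi>" "v \<circ> f"] \<phi>(1,3) by (auto simp: eq formulas_def)
qed

text \<open>The constants from \<open>F \<subseteq> M\<close> become further parameters in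
  \<open>M\<close>, and the quantified variable \<open>x\<close> moves to
  \<open>2 * x\<close>.\<close>

lemma tarski_vaught_const:
  assumes tv: "tarski_vaught L U M" and FM: "F \<subseteq> M"
  shows "tarski_vaught (lang_const L F) (struc_const U) M"
  unfolding tarski_vaught_def
proof (intro ballI allI impI)
  fix \<phi> x v assume \<phi>: "\<phi> \<in> formulas (lang_const L F)" "v ` (fv \<phi> - {x}) \<subseteq> M"
    "\<exists>a\<in>carrier (struc_const U). sat (struc_const U) (v(x := a)) \<phi>"
  then have "wf_fm (lang_const L F) \<phi>" by (simp add: formulas_def)
  then obtain \<phi>' c where \<phi>': "wf_fm L \<phi>'" "\<And>x. 2 * x \<in> fv \<phi>' \<Longrightarrow> x \<in> fv \<phi>"
    "\<And>x. Suc (2 * x) \<in> fv \<phi>' \<Longrightarrow> c (Suc x) \<in> F"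
    "\<And>v. sat (struc_const U) v \<phi> \<longleftrightarrow> sat U (join v c) \<phi>'"
    using ex_unconst by (metis (no_types, lifting))
  have "join v c n \<in> M" if n: "n \<in> fv \<phi>'" "n \<noteq> 2 * x" for n
  proof (cases "even n")
    case True
    then obtain m where "n = 2 * m" by blast
    then show ?thesis using n \<phi>'(2) \<phi>(2) by auto
  next
    case False
    then obtain m where "n = Suc (2 * m)" by (metis oddE Suc_eq_plus1)
    then show ?thesis using n \<phi>'(3) FM by auto
  qed
  then have "join v c ` (fv \<phi>' - {2 * x}) \<subseteq> M" by auto
  then have "(\<exists>a\<in>carrier U. sat U ((join v c)(2 * x := a)) \<phi>') \<longrightarrow>
      (\<exists>a\<in>M. sat U ((join v c)(2 * x := a)) \<phi>')"
    using tv \<phi>'(1) unfolding tarski_vaught_def formulas_def by blast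
  then show "\<exists>a\<in>M. sat (struc_const U) (v(x := a)) \<phi>"
    using \<phi>(3) by (simp add: \<phi>'(4) join_upd_even)
qed

lemma tarski_vaught_small_model:
  fixes U :: "('f, 'r, 'a) struc"
  assumes U: "is_struc L U" and M: "small U M" and tv: "tarski_vaught L U M"
  shows "small_model L (Th L U) U M"
proof -
  let ?N = "U\<lparr>carrier := M\<rparr>"
  have MU: "M \<subseteq> carrier U" using M by (simp add: small_def)
  have "eval ?N v t = eval U v t" for v :: "nat \<Rightarrow> 'a" and t
  proof (induction t)
    case (Fun g ts)
    then have "map (eval ?N v) ts = map (eval U v) ts" by simp
    then show ?case by (simp only: eval.simps) simp
  qed simp
  then have eval: "eval ?N v = eval U v" for v :: "nat \<Rightarrow> 'a" by (simp add: fun_eq_iff)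
  have sat: "\<phi> \<in> formulas L \<Longrightarrow> range v \<subseteq> M \<Longrightarrow> sat ?N v \<phi> = sat U v \<phi>" for \<phi> v
  proof (induction \<phi> arbitrary: v)
    case (Exists x \<phi>)
    have \<phi>: "\<phi> \<in> formulas L" using Exists.prems(1) by (simp add: formulas_def)
    have "sat ?N (v(x := a)) \<phi> = sat U (v(x := a)) \<phi>" if "a \<in> M" for a
      using Exists.prems(2) that by (intro Exists.IH[OF \<phi>]) auto
    moreover have "v ` (fv \<phi> - {x}) \<subseteq> M"
      using Exists.prems(2) by auto
    then have "(\<exists>a\<in>carrier U. sat U (v(x := a)) \<phi>) \<longleftrightarrow> (\<exists>a\<in>M. sat U (v(x := a)) \<phi>)"
      using tv \<phi> MU unfolding tarski_vaught_def by blast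
    ultimately show ?case by simp
  qed (auto simp: eval formulas_def)
  obtain a where "a \<in> carrier U" using U by (auto simp: is_struc_def)
  then have "M \<noteq> {}"
    using tv[unfolded tarski_vaught_def, rule_format, of "Eq (Var 0) (Var 0)" "\<lambda>_. a" 0]
    by (auto simp: formulas_def)
  moreover have "fint U f as \<in> M" if f: "f \<in> fsyms L" "length as = farity L f" "set as \<subseteq> M" for f as
  proof -
    \<comment> \<open>Closure under \<open>f\<close> is the test applied to an equation between
      variable \<open>0\<close> and a value of \<open>f\<close>; the shift by \<open>Suc\<close>
      keeps \<open>0\<close> free for that value.\<close>
    let ?ts = "map (\<lambda>i. Var (Suc i)) [0..<length as]"
    let ?\<phi> = "Eq (Var 0) (Fun f ?ts)" and ?v = "\<lambda>n :: nat. as ! (n - 1)"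
    have "map (eval U (?v(0 := b))) ?ts = as" for b
      by (intro nth_equalityI) auto
    then have eq: "sat U (?v(0 := b)) ?\<phi> \<longleftrightarrow> b = fint U f as" for b
      by (simp only: sat.simps eval.simps) simp
    have "fint U f as \<in> carrier U"
      using U f MU unfolding is_struc_def by blast
    then have "\<exists>b\<in>carrier U. sat U (?v(0 := b)) ?\<phi>"
      unfolding eq by blast
    moreover have "?\<phi> \<in> formulas L"
      using f by (auto simp: formulas_def)
    moreover have "?v ` (fv ?\<phi> - {0}) \<subseteq> M"
      using f(3) by (auto simp: subset_iff)
    ultimately have "\<exists>b\<in>M. sat U (?v(0 := b)) ?\<phi>"
      using tv unfolding tarski_vaught_def by blast
    then show ?thesis unfolding eq by blast
  qed
  ultimately have "elementary_substruc L ?N U"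
    using MU sat unfolding elementary_substruc_def is_struc_def by simp
  moreover have "models ?N (Th L U)"
    unfolding models_def
  proof (intro ballI allI impI)
    fix \<sigma> and v :: "nat \<Rightarrow> 'a" assume \<sigma>: "\<sigma> \<in> Th L U" and v: "range v \<subseteq> carrier ?N"
    then have "sat U v \<sigma>" using MU by (auto simp: Th_def models_def)
    moreover have "\<sigma> \<in> formulas L" using \<sigma> by (simp add: Th_def sentences_def formulas_in_def)
    ultimately show "sat ?N v \<sigma>" using sat v by simp
  qed
  ultimately show ?thesis using M by (simp add: small_model_def)
qed

section \<open>Assembly of the model\<close>

text \<open>After \<open>B\<close> come the elements of \<open>F\<close>, isolated by their
  constants, and then the values of all Henkin terms over \<open>K = B \<union> F\<close>. A
  solvable formula with parameters in \<open>M\<close> is solved by the value of the term it labels,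
  which gives the Tarski-Vaught test.\<close>

lemma ex_constructible_model:
  fixes L' :: "('f, 'r) lang" and U' :: "('f, 'r, 'a) struc"
  assumes cnt: "countable (formulas L')" and mon: "monster_model L' T' U'" and NIP: "NIP L' U'"
    and F: "small U' F" and L: "L = lang_const L' F" and U: "U = struc_const U'"
    and A: "small U A" and B: "small U B" and AB: "constructible L U A B"
  shows "\<exists>M. B \<subseteq> M \<and> small_model L (Th L U) U M \<and> constructible L U A M \<and> M \<lesssim> B <+> formulas L"
proof -
  have cU: "carrier U = carrier U'" by (simp add: U)
  have str: "is_struc L' U'" and unc: "uncountable (carrier U')" and sat: "saturated L' U'"
    using mon by (auto simp: monster_model_def)
  have inf: "infinite (carrier U')" using unc by (rule uncountable_infinite)
  have smallUn: "small U' (X \<union> Y)" if "small U' X" "small U' Y" for X Y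
    using that Un_lesspoll_infinite[OF inf] by (auto simp: small_def)
  have A': "small U' A" and B': "small U' B"
    using A B by (auto simp: small_def cU)
  define K where "K = B \<union> F"
  define D where "D = A \<union> B \<union> F"
  \<comment> \<open>The copy of the natural numbers makes \<open>S\<close> infinite and absorbs the
    countably many formulas, while \<open>S\<close> stays below the uncountable carrier.\<close>
  define S where "S = K <+> (UNIV :: nat set)"
  define J where "J = codes (formulas L') K"
  have D: "small U' D" unfolding D_def by (intro smallUn A' B' F)
  have K: "small U' K" unfolding K_def by (intro smallUn B' F)
  have KD: "K \<subseteq> D" by (auto simp: K_def D_def)
  have infS: "infinite S" unfolding S_def by simp
  have "formulas L' \<lesssim> (UNIV :: nat set)"
    using cnt unfolding countable_def lepoll_def by blast
  also have "(UNIV :: nat set) \<lesssim> S" using infS by (simp add: infinite_le_lepoll)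
  finally have "J \<lesssim> S"
    unfolding J_def using infS by (intro codes_lepoll) (auto simp: S_def lepoll_def intro!: exI[of _ Inl])
  have "(UNIV :: nat set) \<prec> carrier U'"
    using unc by (intro countable_lesspoll_uncountable) auto
  then have "S \<prec> carrier U'"
    unfolding S_def using K inf by (intro Plus_lesspoll_infinite) (auto simp: small_def)
  with \<open>J \<lesssim> S\<close> have J: "J \<prec> carrier U'" by (rule lesspoll_trans1)
  obtain e s where s: "wf s" "total_on J s"
    and e: "\<And>x. x \<in> J \<Longrightarrow> e x \<in> carrier U' \<and>
         compressible_elem L' U' (D \<union> e ` {y \<in> J. (y, x) \<in> s}) (e x)"
      "\<And>b. b \<in> K \<Longrightarrow> e (Elem b) = b"
      "\<And>\<phi> cs a. Node \<phi> cs \<in> J \<Longrightarrow> fv \<phi> \<subseteq> {..<length cs} \<Longrightarrow> a \<in> carrier U' \<Longrightarrow>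
       sat U' ((\<lambda>n. e (cs ! n))(0 := a)) \<phi> \<Longrightarrow> sat U' ((\<lambda>n. e (cs ! n))(0 := e (Node \<phi> cs))) \<phi>"
    by (rule ex_code_enumeration[OF cnt NIP sat inf D KD J[unfolded J_def], folded J_def]) (rule that)
  define M where "M = e ` J"
  have KM: "K \<subseteq> M"
  proof
    fix b assume "b \<in> K"
    then have "Elem b \<in> J" "e (Elem b) = b" using e(2) by (auto simp: J_def)
    then show "b \<in> M" unfolding M_def by force
  qed
  have MJ: "M \<lesssim> J" unfolding M_def by (rule image_lepoll)
  have M: "small U M"
    using lesspoll_trans1[OF MJ J] e(1) by (auto simp: small_def cU M_def)
  have "tarski_vaught L' U' M"
  proof (rule tarski_vaughtI)
    fix \<phi> v a assume \<phi>: "\<phi> \<in> formulas L'" "v ` (fv \<phi> - {0}) \<subseteq> M" "a \<in> carrier U'" "sat U' (v(0 := a)) \<phi>"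
    have nul: "Node (Eq (Var 0) (Var 0)) [] \<in> J" by (simp add: J_def formulas_def)
    \<comment> \<open>Each parameter is named by a code; positions without a parameter get a dummy
      code, so that the list below has an entry at every index.\<close>
    define c where "c = (\<lambda>n. if n \<in> fv \<phi> - {0} then inv_into J e (v n) else Node (Eq (Var 0) (Var 0)) [])"
    have vM: "v n \<in> e ` J" if "n \<in> fv \<phi> - {0}" for n
      using \<phi>(2) that unfolding M_def by blast
    have c: "c n \<in> J" "n \<in> fv \<phi> - {0} \<Longrightarrow> e (c n) = v n" for n
      using nul inv_into_into[OF vM] f_inv_into_f[OF vM] by (auto simp: c_def)
    obtain N where N: "fv \<phi> \<subseteq> {..<N}" using finite_nat_iff_bounded[of "fv \<phi>"] by auto
    let ?cs = "map c [0..<N]"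
    have node: "Node \<phi> ?cs \<in> J" using \<phi>(1) c(1) by (auto simp: J_def)
    have eq: "sat U' ((\<lambda>n. e (?cs ! n))(0 := b)) \<phi> \<longleftrightarrow> sat U' (v(0 := b)) \<phi>" for b
      using N c(2) by (intro sat_cong) auto
    have "sat U' (v(0 := e (Node \<phi> ?cs))) \<phi>"
      using e(3)[OF node _ \<phi>(3)] \<phi>(4) N unfolding eq by simp
    then show "\<exists>a\<in>M. sat U' (v(0 := a)) \<phi>" using node unfolding M_def by blast
  qed
  then have "tarski_vaught L U M"
    unfolding L U using KM by (intro tarski_vaught_const) (auto simp: K_def)
  moreover have "is_struc L U"
    using str F unfolding L U is_struc_def small_def by (auto simp: lang_const_def struc_const_def)
  ultimately have "small_model L (Th L U) U M"
    using M by (intro tarski_vaught_small_model)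
  moreover have "constructible L U A M"
  proof -
    have "constructible L U (A \<union> B) F"
      unfolding L U by (intro constructible_any_order compressible_tp_constant) (use F in \<open>auto simp: small_def\<close>)
    then have "constructible L U A K"
      unfolding K_def by (intro constructible_Un[OF AB])
    moreover have "constructible L U (A \<union> K) M"
      unfolding M_def
    proof (rule constructible_imageI[OF s])
      fix i assume i: "i \<in> J"
      have "D = A \<union> K" by (auto simp: D_def K_def)
      then show "compressible_tp L U (A \<union> K \<union> e ` {j \<in> J. (j, i) \<in> s}) (e i)"
        using e(1)[OF i] unfolding L U
        by (intro compressible_tp_of_elem) (auto simp: K_def)
    qed
    ultimately have "constructible L U A (K \<union> M)" by (rule constructible_Un)
    then show ?thesis using KM by (simp add: sup.absorb2)
  qed
  moreover have "M \<lesssim> B <+> formulas L"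
  proof -
    \<comment> \<open>Elements of \<open>F\<close> outside \<open>B\<close> and natural numbers are
      counted by formulas: \<open>a\<close> by an equation with its constant, \<open>n\<close> by an
      equation of variable \<open>n\<close> with itself. The left-hand sides keep the two kinds
      apart.\<close>
    let ?g = "case_sum (\<lambda>a. if a \<in> B then Inl a else Inr (Eq (Fun (Inr a) []) (Var 0))) (\<lambda>n. Inr (Eq (Var n) (Var n)))"
    have "inj_on ?g S"
      by (auto simp: inj_on_def S_def split: if_splits)
    moreover have "?g ` S \<subseteq> B <+> formulas L"
      by (auto simp: S_def K_def L formulas_def lang_const_def)
    ultimately have "S \<lesssim> B <+> formulas L" unfolding lepoll_def by blast
    then show ?thesis using MJ \<open>J \<lesssim> S\<close> by (meson lepoll_trans)
  qed
  moreover have "B \<subseteq> M" using KM by (simp add: K_def)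
  ultimately show ?thesis by blast
qed

theorem proposition6p29:
  fixes L' :: "('f, 'r) lang"
    and T' :: "('f, 'r) fm set"
    and U' :: "('f, 'r, 'a) struc"
    and F :: "'a set"
    and L :: "('f + 'a, 'r) lang"
    and U :: "('f + 'a, 'r, 'a) struc"
    and T :: "('f + 'a, 'r) fm set"
  assumes "countable (formulas L')"
    and "complete_theory TYPE('a) L' T'"
    and "monster_model L' T' U'"
    and "NIP L' U'"
    and "small U' F"
    and L: "L = lang_const L' F"
    and U: "U = struc_const U'"
    and T: "T = Th L U"
  shows "(\<forall>A. small U A \<longrightarrow>
            (\<exists>M. A \<subseteq> M \<and> small_model L T U M \<and> compressibly_constructible L U A M \<and>
                 M \<lesssim> A <+> formulas L)) \<and>
         (\<forall>A B. small U A \<and> small U B \<and> compressibly_constructible L U A B \<longrightarrow>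
            (\<exists>M. B \<subseteq> M \<and> small_model L T U M \<and> compressibly_constructible L U A M \<and>
                 M \<lesssim> B <+> formulas L))"
proof (intro conjI allI impI)
  note model = ex_constructible_model[OF assms(1,3,4,5) L U]
  fix A assume A: "small U A"
  \<comment> \<open>Elements of \<open>A\<close> are isolated over \<open>A\<close>, so the first
    claim is the second one for \<open>B = A\<close>.\<close>
  then have "constructible L U A A"
    by (intro constructible_any_order compressible_tp_member) (auto simp: small_def)
  then show "\<exists>M. A \<subseteq> M \<and> small_model L T U M \<and> compressibly_constructible L U A M \<and>
      M \<lesssim> A <+> formulas L"
    using model[OF A A] unfolding T constructible_iff_compressibly_constructible by blast
next
  note model = ex_constructible_model[OF assms(1,3,4,5) L U]
  fix A B assume AB: "small U A \<and> small U B \<and> compressibly_constructible L U A B"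
  then show "\<exists>M. B \<subseteq> M \<and> small_model L T U M \<and> compressibly_constructible L U A M \<and>
      M \<lesssim> B <+> formulas L"
    using model[of A B] unfolding T constructible_iff_compressibly_constructible by blast
qed

end
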